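(* Let $N\ge 1$, $0=s_0<t_1<s_1<t_2<s_2<\dots<t_N<s_N<t_{N+1}=T$, let $\alpha_0,\alpha_1,\dots,\alpha_N\in\mathbb{R}$ be constants, and let $p:\bigcup_{i=0}^{N}(s_i,t_{i+1}]\to\mathbb{R}$ with $p\in L^2(s_i,t_{i+1}]$ for each $i=0,1,\dots,N$. For $i=0,1,\dots,N$ let $F_i:(s_i,t_{i+1}]\times\mathbb{R}\to\mathbb{R}$ be such that $F_i(t,x)$ is measurable in $t$ for every $x\in\mathbb{R}$ and continuously differentiable in $x$ for a.e. $t\in(s_i,t_{i+1}]$, and let $D_xF_i$ denote its derivative with respect to $x$. Suppose that: (H1) There exist $a\in C(\mathbb{R}^+,\mathbb{R}^+)$ and $b\in L^1(s_i,t_{i+1};\mathbb{R}^+)$ ($i=0,1,\dots,N$) such that $|F_i(t,x)|\le a(|x|)b(t)$ and $|D_xF_i(t,x)|\le a(|x|)b(t)$ for all $x\in\mathbb{R}$, and $F_i(t,0)=0$, for a.e. $t\in(s_i,t_{i+1})$, $i=0,1,\dots,N$. (H2) There exist constants $\mu_i>2$ such that $0<\mu_iF_i(t,x)\le x\,D_xF_i(t,x)$ for a.e. $t\in(s_i,t_{i+1}]$ and all $x\in\mathbb{R}\setminus\{0\}$, $i=0,1,\dots,N$. (H3) $\displaystyle\sum_{i=0}^{N}\sqrt{t_{i+1}-s_i}\,\|p\|_{L^2}<M$, where $$M=\frac{1}{8\beta^2}-\frac12\sum_{i=1}^{N}|\alpha_{i-1}-\alpha_i|-\sum_{i=0}^{N}\int_{s_i}^{t_{i+1}}M_i(t)\,dt,$$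 $$\beta=(T\lambda_1)^{-1/2}+T^{1/2},\qquad M_i(t):=\max_{|x|=1}F_i(t,x)\quad(i=0,1,\dots,N).$$ Then the problem $$\begin{cases}-u''(t)=D_xF_i(t,u(t)-u(t_{i+1}))+p(t), & t\in(s_i,t_{i+1}],\ i=0,1,\dots,N,\\ u'(t)=\alpha_i, & t\in(t_i,s_i],\ i=1,\dots,N,\\ u'(s_i^+)=u'(s_i^-), & i=1,\dots,N,\\ u(0)=u(T)=0,\quad u'(0)=\alpha_0,\end{cases}$$ has at least one weak solution.
   Context: Here $\mathbb{R}^+=[0,\infty)$ and $u'(s_i^{\pm})=\lim_{s\to s_i^{\pm}}u'(s)$. $\lambda_1$ denotes the first eigenvalue of the problem $-u''(t)=\lambda u(t)$, $t\in[0,T]$, $u(0)=u(T)=0$. The norm is $\|u\|_{L^2}=\left(\int_0^T|u(t)|^2dt\right)^{1/2}$. In $\|p\|_{L^2}$, the function $p$ is regarded as extended by $0$ outside $\bigcup_{i=0}^N(s_i,t_{i+1}]$. A weak solution of the problem is a function $u\in H_0^1(0,T)$ such that for every $v\in H_0^1(0,T)$, $$-\int_0^Tu'v'\,dt+\sum_{i=1}^N(\alpha_{i-1}-\alpha_i)v(t_i)=-\sum_{i=0}^N\int_{s_i}^{t_{i+1}}\bigl(D_xF_i(t,u(t)-u(t_{i+1}))+p(t)\bigr)\bigl(v(t)-v(t_{i+1})\bigr)\,dt.$$ *)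

theory Defs
  imports "HOL-Analysis.Analysis"
begin

definition L2_on :: "real set \<Rightarrow> (real \<Rightarrow> real) \<Rightarrow> bool" where
  "L2_on A f \<longleftrightarrow> set_borel_measurable lebesgue A f \<and> set_integrable lebesgue A (\<lambda>\<tau>. (f \<tau>)\<^sup>2)"

definition L2_norm :: "real \<Rightarrow> (real \<Rightarrow> real) \<Rightarrow> real" where
  "L2_norm T f = sqrt (LINT \<tau>:{0..T}|lebesgue. \<bar>f \<tau>\<bar>\<^sup>2)"

definition C1_compact_support :: "real set \<Rightarrow> (real \<Rightarrow> real) \<Rightarrow> bool" where
  "C1_compact_support U \<phi> \<longleftrightarrow>
     \<phi> C1_differentiable_on UNIV \<and> (\<exists>K. compact K \<and> K \<subseteq> U \<and> (\<forall>x. x \<notin> K \<longrightarrow> \<phi> x = 0))"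

text \<open>Weak derivatives are only determined up to null sets, hence a relation. Test functions of
  class \<open>C\<^sup>1\<close> with compact support give the same notion as smooth ones.\<close>

definition has_weak_L2_deriv :: "real \<Rightarrow> (real \<Rightarrow> real) \<Rightarrow> (real \<Rightarrow> real) \<Rightarrow> bool" where
  "has_weak_L2_deriv T u u' \<longleftrightarrow> L2_on {0<..<T} u' \<and>
     (\<forall>\<phi>. C1_compact_support {0<..<T} \<phi> \<longrightarrow>
        (LINT \<tau>:{0<..<T}|lebesgue. u \<tau> * deriv \<phi> \<tau>)
          = - (LINT \<tau>:{0<..<T}|lebesgue. u' \<tau> * \<phi> \<tau>))"

text \<open>Elements of \<open>H\<^sub>0\<^sup>1(0,T)\<close> are represented by their continuous representatives on
  \<open>[0,T]\<close>, so that point evaluations are meaningful; values outside \<open>[0,T]\<close> are irrelevant.\<close>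

definition H01 :: "real \<Rightarrow> (real \<Rightarrow> real) set" where
  "H01 T = {u. L2_on {0<..<T} u \<and> (\<exists>u'. has_weak_L2_deriv T u u') \<and>
               continuous_on {0..T} u \<and> u 0 = 0 \<and> u T = 0}"

definition dirichlet_eigenvalue :: "real \<Rightarrow> real \<Rightarrow> bool" where
  "dirichlet_eigenvalue T lam \<longleftrightarrow>
     (\<exists>u u'. (\<forall>\<tau>\<in>{0..T}. (u has_real_derivative u' \<tau>) (at \<tau> within {0..T}) \<and>
                          (u' has_real_derivative - (lam * u \<tau>)) (at \<tau> within {0..T})) \<and>
             u 0 = 0 \<and> u T = 0 \<and> (\<exists>\<tau>\<in>{0..T}. u \<tau> \<noteq> 0))"

definition first_eigenvalue :: "real \<Rightarrow> real" where
  "first_eigenvalue T = (LEAST lam. dirichlet_eigenvalue T lam)"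

text \<open>Here \<open>T = t (Suc N)\<close>, and \<open>D\<^sub>xF\<^sub>i(\<tau>,x)\<close> is \<open>deriv (F i \<tau>) x\<close>.\<close>

definition weak_solution ::
  "nat \<Rightarrow> (nat \<Rightarrow> real) \<Rightarrow> (nat \<Rightarrow> real) \<Rightarrow> (nat \<Rightarrow> real) \<Rightarrow> (nat \<Rightarrow> real \<Rightarrow> real \<Rightarrow> real) \<Rightarrow>
   (real \<Rightarrow> real) \<Rightarrow> (real \<Rightarrow> real) \<Rightarrow> bool" where
  "weak_solution N s t \<alpha> F p u \<longleftrightarrow>
     u \<in> H01 (t (Suc N)) \<and>
     (\<exists>u'. has_weak_L2_deriv (t (Suc N)) u u' \<and>
       (\<forall>v v'. v \<in> H01 (t (Suc N)) \<longrightarrow> has_weak_L2_deriv (t (Suc N)) v v' \<longrightarrow>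
          - (LINT \<tau>:{0<..<t (Suc N)}|lebesgue. u' \<tau> * v' \<tau>)
            + (\<Sum>i=1..N. (\<alpha> (i - 1) - \<alpha> i) * v (t i))
          = - (\<Sum>i=0..N. LINT \<tau>:{s i<..t (Suc i)}|lebesgue.
                 (deriv (F i \<tau>) (u \<tau> - u (t (Suc i))) + p \<tau>) * (v \<tau> - v (t (Suc i))))))"

end

theory Submission
  imports Defs "HOL-Complex_Analysis.Great_Picard"
begin

text \<open>Weak solutions are the critical points of the functional
  \<open>\<phi>(u) = 1/2 \<parallel>u'\<parallel>\<^sup>2 - G(u)\<close> on \<open>H\<^sub>0\<^sup>1(0,T)\<close>, where \<open>G\<close> collects the jump terms
  \<open>(\<alpha>\<^bsub>i-1\<^esub> - \<alpha>\<^bsub>i\<^esub>) u(t\<^bsub>i\<^esub>)\<close> and the integrals over the pieces \<open>(s\<^bsub>i\<^esub>, t\<^bsub>i+1\<^esub>]\<close> of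
  \<open>F\<^bsub>i\<^esub>(\<tau>, w) + p(\<tau>) w\<close> with \<open>w = u(\<tau>) - u(t\<^bsub>i+1\<^esub>)\<close>. The smallness condition on \<open>p\<close> makes
  \<open>\<phi>\<close> positive on a sphere around \<open>0\<close>, so that a local minimum lies inside, and the direct method
  finds it.

  The Sobolev inequality \<open>\<bar>u(x) - u(y)\<bar> \<le> \<parallel>u'\<parallel> sqrt \<bar>x - y\<bar>\<close> (lemma \<open>weak_pair_Hoelder\<close>) and
  \<open>sqrt T \<le> \<beta>\<close> show that on the ball \<open>\<parallel>u'\<parallel> \<le> 1 / (2 \<beta>)\<close> all increments of \<open>u\<close> are at most \<open>1/2\<close> in absolute
  value. For such arguments the superlinearity condition gives \<open>F\<^bsub>i\<^esub> \<le> M\<^bsub>i\<^esub>\<close>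
  (\<open>superlinear_le_Max_unit_sphere\<close>). Hence on the boundary sphere \<open>\<phi>\<close> is at least
  \<open>1 / (8 \<beta>\<^sup>2)\<close> minus the bounds of the jump terms, of the integrals of \<open>M\<^bsub>i\<^esub>\<close> and of the forcing
  term, which is positive by hypothesis, while \<open>\<phi>(0) = 0\<close>. A minimiser of \<open>\<phi>\<close> over the closed ball
  thus lies in its interior, where the one-sided difference quotients in the directions \<open>v\<close> and \<open>-v\<close>
  yield the weak equation (\<open>critical_point_in_ball\<close>).

  The minimiser exists because \<open>G\<close> is continuous under uniform convergence
  (\<open>load_continuous\<close>) and a minimising sequence has a uniformly convergent subsequence by the
  Arzela--Ascoli theorem. Uniform convexity of the leading term then makes the derivatives converge
  in the mean square (\<open>weak_pair_ball_minimizer\<close>), so the limit belongs to the ball and attains the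
  infimum.\<close>

section \<open>Square integrable functions\<close>

definition square_integrable :: "'a measure \<Rightarrow> ('a \<Rightarrow> real) \<Rightarrow> bool" where
  "square_integrable M f \<longleftrightarrow> f \<in> borel_measurable M \<and> integrable M (\<lambda>x. (f x)\<^sup>2)"

lemma square_integrable_mult_integrable:
  assumes "square_integrable M f" "square_integrable M g"
  shows "integrable M (\<lambda>x. f x * g x)"
proof (rule Bochner_Integration.integrable_bound)
  show "integrable M (\<lambda>x. (f x)\<^sup>2 + (g x)\<^sup>2)"
    using assms by (auto simp: square_integrable_def)
  show "(\<lambda>x. f x * g x) \<in> borel_measurable M"
    using assms by (auto simp: square_integrable_def)
  have "\<bar>a * b\<bar> \<le> a\<^sup>2 + b\<^sup>2" for a b :: real
  proof -
    have "2 * \<bar>a\<bar> * \<bar>b\<bar> \<le> a\<^sup>2 + b\<^sup>2" using sum_squares_bound[of "\<bar>a\<bar>" "\<bar>b\<bar>"] by simp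
    moreover have "0 \<le> \<bar>a\<bar> * \<bar>b\<bar>" by simp
    ultimately show ?thesis unfolding abs_mult by linarith
  qed
  then show "AE x in M. norm (f x * g x) \<le> norm ((f x)\<^sup>2 + (g x)\<^sup>2)"
    by auto
qed

lemma square_integrable_lincomb:
  assumes "square_integrable M f" "square_integrable M g"
  shows "square_integrable M (\<lambda>x. a * f x + b * g x)"
proof -
  have "(\<lambda>x. (a * f x + b * g x)\<^sup>2) =
     (\<lambda>x. a\<^sup>2 * (f x)\<^sup>2 + (2 * a * b * (f x * g x) + b\<^sup>2 * (g x)\<^sup>2))"
    by (auto simp: power2_eq_square algebra_simps)
  then show ?thesis
    using assms square_integrable_mult_integrable[OF assms] by (auto simp: square_integrable_def)
qed

lemma integral_lincomb_square:
  assumes "square_integrable M f" "square_integrable M g"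
  shows "(\<integral>x. (a * f x + b * g x)\<^sup>2 \<partial>M) =
     a\<^sup>2 * (\<integral>x. (f x)\<^sup>2 \<partial>M) + 2 * a * b * (\<integral>x. f x * g x \<partial>M) + b\<^sup>2 * (\<integral>x. (g x)\<^sup>2 \<partial>M)"
proof -
  have "(\<lambda>x. (a * f x + b * g x)\<^sup>2) =
     (\<lambda>x. a\<^sup>2 * (f x)\<^sup>2 + (2 * a * b * (f x * g x) + b\<^sup>2 * (g x)\<^sup>2))"
    by (auto simp: power2_eq_square algebra_simps)
  then show ?thesis
    using assms square_integrable_mult_integrable[OF assms] by (simp add: square_integrable_def)
qed

lemma integral_Cauchy_Schwarz:
  assumes f: "square_integrable M f" and g: "square_integrable M g"
  shows "\<bar>\<integral>x. f x * g x \<partial>M\<bar> \<le> sqrt (\<integral>x. (f x)\<^sup>2 \<partial>M) * sqrt (\<integral>x. (g x)\<^sup>2 \<partial>M)"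
proof -
  define A B C where "A = (\<integral>x. (f x)\<^sup>2 \<partial>M)" and "B = (\<integral>x. f x * g x \<partial>M)"
    and "C = (\<integral>x. (g x)\<^sup>2 \<partial>M)"
  have quad: "0 \<le> a\<^sup>2 * A + 2 * a * b * B + b\<^sup>2 * C" for a b
    unfolding A_def B_def C_def integral_lincomb_square[OF f g, symmetric] by simp
  have C0: "C \<ge> 0" by (simp add: C_def)
  have "B\<^sup>2 \<le> A * C"
  proof (cases "C = 0")
    case True
    then have "AE x in M. (g x)\<^sup>2 = 0"
      using g unfolding C_def square_integrable_def by (subst (asm) integral_nonneg_eq_0_iff_AE) auto
    then have "AE x in M. f x * g x = 0" by eventually_elim auto
    then have "B = 0" unfolding B_def by (rule integral_eq_zero_AE)
    with True show ?thesis by simp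
  next
    case False
    with C0 have "C > 0" by simp
    have "0 \<le> C\<^sup>2 * A + 2 * C * (- B) * B + (- B)\<^sup>2 * C" by (rule quad)
    also have "\<dots> = C * (A * C - B\<^sup>2)" by (simp add: power2_eq_square algebra_simps)
    finally show ?thesis using \<open>C > 0\<close> by (simp add: zero_le_mult_iff)
  qed
  then have "sqrt (B\<^sup>2) \<le> sqrt (A * C)" by (rule real_sqrt_le_mono)
  then show ?thesis unfolding A_def B_def C_def by (simp add: real_sqrt_mult)
qed

lemma square_integrable_nn_integral:
  assumes "square_integrable M f"
  shows "(\<integral>\<^sup>+x. ennreal ((f x)\<^sup>2) \<partial>M) = ennreal (\<integral>x. (f x)\<^sup>2 \<partial>M)"
  using assms by (intro nn_integral_eq_integral) (auto simp: square_integrable_def)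

text \<open>The weighted series \<open>\<Sum>n. 2\<^sup>n (g\<^bsub>n+1\<^esub> - g\<^bsub>n\<^esub>)\<^sup>2\<close> has finite integral, hence a finite
  value \<open>C\<close> almost everywhere; there each increment is at most \<open>sqrt C * (1 / sqrt 2)\<^sup>n\<close>, and these
  bounds are summable.\<close>

lemma L2_fast_Cauchy_AE_convergent:
  assumes g: "\<And>n. square_integrable M (g n)"
    and fast: "\<And>n. (\<integral>x. (g (Suc n) x - g n x)\<^sup>2 \<partial>M) \<le> (1/4) ^ n"
  shows "AE x in M. convergent (\<lambda>n. g n x)"
proof -
  have [measurable]: "g n \<in> borel_measurable M" for n
    using g by (simp add: square_integrable_def)
  have d: "square_integrable M (\<lambda>x. g (Suc n) x - g n x)" for n
    using square_integrable_lincomb[OF g[of "Suc n"] g[of n], of 1 "-1"] by simp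
  define H where "H x = (\<Sum>n. ennreal (2^n * (g (Suc n) x - g n x)\<^sup>2))" for x
  have Hm: "H \<in> borel_measurable M" unfolding H_def by measurable
  have "(\<integral>\<^sup>+x. H x \<partial>M) = (\<Sum>n. \<integral>\<^sup>+x. ennreal (2^n * (g (Suc n) x - g n x)\<^sup>2) \<partial>M)"
    unfolding H_def by (rule nn_integral_suminf) measurable
  also have "\<dots> \<le> (\<Sum>n. ennreal ((1/2) ^ n))"
  proof (rule suminf_le)
    fix n
    have "(\<integral>\<^sup>+x. ennreal (2^n * (g (Suc n) x - g n x)\<^sup>2) \<partial>M)
        = ennreal (2^n) * ennreal (\<integral>x. (g (Suc n) x - g n x)\<^sup>2 \<partial>M)"
      by (simp add: ennreal_mult nn_integral_cmult square_integrable_nn_integral[OF d])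
    also have "\<dots> = ennreal (2^n * (\<integral>x. (g (Suc n) x - g n x)\<^sup>2 \<partial>M))"
      by (simp add: ennreal_mult)
    also have "\<dots> \<le> ennreal (2^n * (1/4)^n)"
      by (intro ennreal_leI mult_left_mono fast) auto
    also have "2^n * (1/4)^n = ((1/2)^n :: real)"
      by (simp flip: power_mult_distrib)
    finally show "(\<integral>\<^sup>+x. ennreal (2^n * (g (Suc n) x - g n x)\<^sup>2) \<partial>M) \<le> ennreal ((1/2)^n)" .
  qed auto
  also have "\<dots> = ennreal (\<Sum>n. (1/2)^n)"
    by (intro suminf_ennreal2) (auto intro!: summable_geometric)
  also have "\<dots> < \<infinity>" by simp
  finally have "AE x in M. H x \<noteq> \<infinity>"
    using Hm by (intro nn_integral_PInf_AE) auto
  then show ?thesis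
  proof eventually_elim
    fix x assume fin: "H x \<noteq> \<infinity>"
    define C where "C = enn2real (H x)"
    have HC: "H x = ennreal C" unfolding C_def using fin by (simp add: less_top)
    have C0: "0 \<le> C" by (simp add: C_def)
    have bd: "\<bar>g (Suc n) x - g n x\<bar> \<le> sqrt C * (1 / sqrt 2)^n" for n
    proof -
      have "ennreal (2^n * (g (Suc n) x - g n x)\<^sup>2) \<le> H x"
        unfolding H_def using sum_le_suminf[OF summableI, of "{n}" "\<lambda>n. ennreal (2^n * (g (Suc n) x - g n x)\<^sup>2)"]
        by (metis (no_types, lifting) empty_iff finite.emptyI finite.insertI sum.empty sum.insert add.right_neutral zero_le)
      then have "2^n * (g (Suc n) x - g n x)\<^sup>2 \<le> C"
        unfolding HC using C0 by (simp add: ennreal_le_iff)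
      then have "sqrt (2^n * (g (Suc n) x - g n x)\<^sup>2) \<le> sqrt C" by (rule real_sqrt_le_mono)
      then have "sqrt 2 ^ n * \<bar>g (Suc n) x - g n x\<bar> \<le> sqrt C"
        by (simp add: real_sqrt_mult real_sqrt_power[of 2 n])
      then show ?thesis
        by (simp add: power_divide pos_le_divide_eq mult.commute)
    qed
    have "summable (\<lambda>n. g (Suc n) x - g n x)"
    proof (rule summable_comparison_test')
      show "summable (\<lambda>n. sqrt C * (1 / sqrt 2)^n)"
        by (intro summable_mult summable_geometric) simp
    qed (use bd in auto)
    then have "convergent (\<lambda>n. \<Sum>i<n. g (Suc i) x - g i x)"
      by (simp add: summable_iff_convergent)
    then have "convergent (\<lambda>n. (g n x - g 0 x) + g 0 x)"
      by (intro convergent_add convergent_const) (simp only: sum_lessThan_telescope[of "\<lambda>n. g n x"])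
    then show "convergent (\<lambda>n. g n x)" by simp
  qed
qed

text \<open>The Riesz--Fischer argument: a fast subsequence converges almost everywhere, and Fatou's
  lemma applied to \<open>(g\<^bsub>k j\<^esub> - g\<^bsub>n\<^esub>)\<^sup>2\<close> turns the pointwise limit into a limit in mean square
  of the whole sequence.\<close>

lemma L2_complete:
  assumes g: "\<And>n. square_integrable M (g n)"
    and Cauchy: "\<And>e. e > 0 \<Longrightarrow> \<exists>K. \<forall>m\<ge>K. \<forall>n\<ge>K. (\<integral>x. (g m x - g n x)\<^sup>2 \<partial>M) \<le> e"
  obtains h where "square_integrable M h" "(\<lambda>n. \<integral>x. (h x - g n x)\<^sup>2 \<partial>M) \<longlonglongrightarrow> 0"
proof -
  have gm [measurable]: "g n \<in> borel_measurable M" for n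
    using g by (simp add: square_integrable_def)
  have d: "square_integrable M (\<lambda>x. g m x - g n x)" for m n
    using square_integrable_lincomb[OF g[of m] g[of n], of 1 "-1"] by simp
  have "\<forall>j. \<exists>K. \<forall>m\<ge>K. \<forall>n\<ge>K. (\<integral>x. (g m x - g n x)\<^sup>2 \<partial>M) \<le> (1/4)^j"
    by (intro allI Cauchy) simp
  then obtain K where "\<forall>j. \<forall>m\<ge>K j. \<forall>n\<ge>K j. (\<integral>x. (g m x - g n x)\<^sup>2 \<partial>M) \<le> (1/4)^j"
    by (rule choice[elim_format]) blast
  then have K: "\<And>j m n. m \<ge> K j \<Longrightarrow> n \<ge> K j \<Longrightarrow> (\<integral>x. (g m x - g n x)\<^sup>2 \<partial>M) \<le> (1/4)^j"
    by blast
  \<comment> \<open>The partial sums make \<open>k\<close> monotone, and the summand \<open>j\<close> makes it tend to infinity.\<close>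
  define k where "k j = (\<Sum>i\<le>j. K i) + j" for j
  have kK: "k j \<ge> K j" for j unfolding k_def by (simp add: member_le_sum trans_le_add1)
  have kj: "k j \<ge> j" for j unfolding k_def by simp
  have kmono: "k j \<le> k (Suc j)" for j unfolding k_def by simp
  have "AE x in M. convergent (\<lambda>j. g (k j) x)"
    by (rule L2_fast_Cauchy_AE_convergent) (use g K kK kmono le_trans in blast)+
  moreover define h where "h x = lim (\<lambda>j. g (k j) x)" for x
  ultimately have conv: "AE x in M. (\<lambda>j. g (k j) x) \<longlonglongrightarrow> h x"
    by (simp add: convergent_LIMSEQ_iff)
  have hm [measurable]: "h \<in> borel_measurable M" unfolding h_def by measurable
  have est: "(\<integral>\<^sup>+x. ennreal ((h x - g n x)\<^sup>2) \<partial>M) \<le> ennreal e"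
    if KK: "\<And>m. m \<ge> K' \<Longrightarrow> (\<integral>x. (g m x - g n x)\<^sup>2 \<partial>M) \<le> e" for n e K'
  proof -
    have "(\<integral>\<^sup>+x. ennreal ((h x - g n x)\<^sup>2) \<partial>M) =
          (\<integral>\<^sup>+x. liminf (\<lambda>j. ennreal ((g (k j) x - g n x)\<^sup>2)) \<partial>M)"
    proof (rule nn_integral_cong_AE)
      show "AE x in M. ennreal ((h x - g n x)\<^sup>2) = liminf (\<lambda>j. ennreal ((g (k j) x - g n x)\<^sup>2))"
        using conv
      proof eventually_elim
        fix x assume "(\<lambda>j. g (k j) x) \<longlonglongrightarrow> h x"
        then have "(\<lambda>j. ennreal ((g (k j) x - g n x)\<^sup>2)) \<longlonglongrightarrow> ennreal ((h x - g n x)\<^sup>2)"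
          by (intro tendsto_intros)
        then show "ennreal ((h x - g n x)\<^sup>2) = liminf (\<lambda>j. ennreal ((g (k j) x - g n x)\<^sup>2))"
          by (rule lim_imp_Liminf[OF trivial_limit_sequentially, symmetric])
      qed
    qed
    also have "\<dots> \<le> liminf (\<lambda>j. \<integral>\<^sup>+x. ennreal ((g (k j) x - g n x)\<^sup>2) \<partial>M)"
      by (rule nn_integral_liminf) measurable
    also have "\<dots> \<le> ennreal e"
    proof (rule Liminf_le)
      have "\<forall>\<^sub>F j in sequentially. k j \<ge> K'"
        unfolding eventually_sequentially using le_trans[OF _ kj] by blast
      then show "\<forall>\<^sub>F j in sequentially. (\<integral>\<^sup>+x. ennreal ((g (k j) x - g n x)\<^sup>2) \<partial>M) \<le> ennreal e"
        by eventually_elim (simp add: square_integrable_nn_integral[OF d] ennreal_leI KK)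
    qed simp
    finally show ?thesis .
  qed
  have "(\<integral>\<^sup>+x. ennreal ((h x - g (K 0) x)\<^sup>2) \<partial>M) \<le> ennreal 1"
    by (rule est[of "K 0"]) (use K[of 0 _ "K 0"] in auto)
  then have "(\<integral>\<^sup>+x. ennreal ((h x - g (K 0) x)\<^sup>2) \<partial>M) < \<infinity>"
    using order.strict_trans1 by fastforce
  then have "integrable M (\<lambda>x. (h x - g (K 0) x)\<^sup>2)"
    by (intro integrableI_bounded) auto
  then have "square_integrable M (\<lambda>x. h x - g (K 0) x)"
    by (simp add: square_integrable_def)
  from square_integrable_lincomb[OF this g[of "K 0"], of 1 1]
  have hS: "square_integrable M h" by simp
  have hd: "square_integrable M (\<lambda>x. h x - g n x)" for n
    using square_integrable_lincomb[OF hS g[of n], of 1 "-1"] by simp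
  have "(\<lambda>n. \<integral>x. (h x - g n x)\<^sup>2 \<partial>M) \<longlonglongrightarrow> 0"
  proof (rule LIMSEQ_I)
    fix r :: real assume "0 < r"
    then obtain K' where K': "\<forall>m\<ge>K'. \<forall>n\<ge>K'. (\<integral>x. (g m x - g n x)\<^sup>2 \<partial>M) \<le> r/2"
      using Cauchy[of "r/2"] by auto
    have "(\<integral>x. (h x - g n x)\<^sup>2 \<partial>M) \<le> r/2" if "n \<ge> K'" for n
    proof -
      have "(\<integral>\<^sup>+x. ennreal ((h x - g n x)\<^sup>2) \<partial>M) \<le> ennreal (r/2)"
        by (rule est[of K']) (use K' that in auto)
      then show ?thesis
        using \<open>0 < r\<close> by (simp add: square_integrable_nn_integral[OF hd] ennreal_le_iff)
    qed
    then show "\<exists>no. \<forall>n\<ge>no. norm ((\<integral>x. (h x - g n x)\<^sup>2 \<partial>M) - 0) < r"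
      using \<open>0 < r\<close> by (intro exI[of _ K']) fastforce
  qed
  with hS show ?thesis by (rule that)
qed

section \<open>Integrals over intervals and a \<open>C\<^sup>1\<close> approximation of indicators\<close>

lemma L2_on_iff_square_integrable:
  assumes "A \<in> sets lebesgue"
  shows "L2_on A f \<longleftrightarrow> square_integrable (lebesgue_on A) f"
  unfolding L2_on_def square_integrable_def set_borel_measurable_def set_integrable_def
  using assms by (simp add: integrable_restrict_space borel_measurable_restrict_space_iff)

lemma set_lebesgue_integral_eq_lebesgue_on:
  fixes f :: "real \<Rightarrow> real"
  assumes "A \<in> sets lebesgue"
  shows "(LINT x:A|lebesgue. f x) = (\<integral>x. f x \<partial>lebesgue_on A)"
  using assms by (simp add: set_lebesgue_integral_def integral_restrict_space)

lemma integrable_lebesgue_on_subset: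
  fixes f :: "real \<Rightarrow> real"
  assumes "integrable (lebesgue_on B) f" "A \<subseteq> B" "A \<in> sets lebesgue" "B \<in> sets lebesgue"
  shows "integrable (lebesgue_on A) f"
  using assms set_integrable_subset[of lebesgue B f A]
  by (auto simp: set_integrable_def integrable_restrict_space)

lemma integrable_lebesgue_on_Ioo_if_continuous:
  fixes f :: "real \<Rightarrow> real"
  assumes "continuous_on {a..b} f"
  shows "integrable (lebesgue_on {a<..<b}) f"
  by (rule integrable_lebesgue_on_subset[OF continuous_imp_integrable_real[OF assms]]) auto

lemma square_integrable_if_continuous:
  fixes f :: "real \<Rightarrow> real"
  assumes "continuous_on {a..b} f"
  shows "square_integrable (lebesgue_on {a<..<b}) f"
  unfolding square_integrable_def
  using integrable_lebesgue_on_Ioo_if_continuous[OF assms]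
    integrable_lebesgue_on_Ioo_if_continuous[of a b "\<lambda>x. (f x)\<^sup>2"] assms
  by (auto intro!: continuous_intros)

definition tent :: "real \<Rightarrow> real" where
  "tent z = max 0 (z + 1) - 2 * max 0 z + max 0 (z - 1)"

text \<open>The antiderivative of \<^const>\<open>tent\<close> that climbs from \<open>0\<close> to \<open>1\<close> on \<open>[-1, 1]\<close>, obtained by
  integrating each positive part. A difference of two rescaled copies is a \<open>C\<^sup>1\<close> approximation of the
  indicator of an interval.\<close>

definition smooth_step :: "real \<Rightarrow> real" where
  "smooth_step z = (max 0 (z + 1))\<^sup>2 / 2 - (max 0 z)\<^sup>2 + (max 0 (z - 1))\<^sup>2 / 2"

text \<open>The square of the positive part is continuously differentiable although the positive part has
  a corner at \<open>0\<close>; all test functions below are built from it.\<close>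

lemma DERIV_half_square_positive_part:
  "((\<lambda>z. (max 0 z)\<^sup>2 / 2) has_real_derivative max 0 z) (at z)" for z :: real
proof -
  consider "z < 0" | "z = 0" | "z > 0" by linarith
  then show ?thesis
  proof cases
    case 1
    have "((\<lambda>z. 0) has_real_derivative max 0 z) (at z)" using 1 by simp
    then show ?thesis
      by (rule has_field_derivative_transform_within_open[of _ _ _ "{..<0}"]) (use 1 in auto)
  next
    case 2
    have "isCont (\<lambda>z. max 0 z / 2) (0::real)" by (intro continuous_intros) auto
    then show ?thesis unfolding CARAT_DERIV
      by (intro exI[of _ "\<lambda>z. max 0 z / 2"]) (auto simp: 2 power2_eq_square max_def)
  next
    case 3
    have "((\<lambda>z. z\<^sup>2 / 2) has_real_derivative max 0 z) (at z)"
      using 3 by (auto intro!: derivative_eq_intros)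
    then show ?thesis
      by (rule has_field_derivative_transform_within_open[of _ _ _ "{0<..}"]) (use 3 in auto)
  qed
qed

lemma DERIV_smooth_step: "(smooth_step has_real_derivative tent z) (at z)"
proof -
  have q: "((\<lambda>z. (max 0 (z + c))\<^sup>2 / 2) has_real_derivative max 0 (z + c)) (at z)" for c
    using DERIV_half_square_positive_part[of "z + c"] by (subst (asm) DERIV_shift)
  have "((\<lambda>z. (max 0 (z + 1))\<^sup>2 / 2 - 2 * ((max 0 (z + 0))\<^sup>2 / 2) + (max 0 (z + (-1)))\<^sup>2 / 2)
    has_real_derivative max 0 (z + 1) - 2 * max 0 (z + 0) + max 0 (z + (-1))) (at z)"
    by (intro DERIV_add DERIV_diff DERIV_cmult q)
  then show ?thesis by (simp add: smooth_step_def[abs_def] tent_def)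
qed

lemma tent_nonneg: "tent z \<ge> 0" and tent_eq_0: "\<bar>z\<bar> \<ge> 1 \<Longrightarrow> tent z = 0"
  by (auto simp: tent_def max_def)

lemma continuous_tent: "continuous_on S tent"
  unfolding tent_def[abs_def] by (intro continuous_intros)

lemma smooth_step_left: "z \<le> -1 \<Longrightarrow> smooth_step z = 0"
  and smooth_step_right: "z \<ge> 1 \<Longrightarrow> smooth_step z = 1"
  by (auto simp: smooth_step_def max_def power2_eq_square field_simps)

lemma smooth_step_mono: "z \<le> w \<Longrightarrow> smooth_step z \<le> smooth_step w"
  by (rule DERIV_nonneg_imp_nondecreasing) (use DERIV_smooth_step tent_nonneg in blast)+

lemma smooth_step_bounds: "0 \<le> smooth_step z" "smooth_step z \<le> 1"
proof -
  have "smooth_step (min z (-1)) \<le> smooth_step z" by (rule smooth_step_mono) simp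
  then show "0 \<le> smooth_step z" by (simp add: smooth_step_left)
  have "smooth_step z \<le> smooth_step (max z 1)" by (rule smooth_step_mono) simp
  then show "smooth_step z \<le> 1" by (simp add: smooth_step_right)
qed

text \<open>An approximate identity at \<open>x\<close>, supported in \<open>[x - e, x + e]\<close>.\<close>

definition tent_kernel :: "real \<Rightarrow> real \<Rightarrow> real \<Rightarrow> real" where
  "tent_kernel e x z = tent ((z - x) / e) / e"

lemma DERIV_scaled_step:
  assumes "e > 0"
  shows "((\<lambda>z. smooth_step ((z - x) / e)) has_real_derivative tent_kernel e x z) (at z)"
proof -
  have "((\<lambda>z. (z - x) / e) has_real_derivative 1 / e) (at z)"
    using assms by (auto intro!: derivative_eq_intros)
  from DERIV_chain2[OF DERIV_smooth_step this] show ?thesis by (simp add: tent_kernel_def)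
qed

lemma continuous_tent_kernel: "e > 0 \<Longrightarrow> continuous_on S (tent_kernel e x)"
  unfolding tent_kernel_def[abs_def]
  by (intro continuous_intros continuous_on_compose2[OF continuous_tent[of UNIV]]) auto

lemma tent_kernel_nonneg: "e > 0 \<Longrightarrow> tent_kernel e x z \<ge> 0"
  by (simp add: tent_kernel_def tent_nonneg)

lemma tent_kernel_eq_0: "e > 0 \<Longrightarrow> \<bar>z - x\<bar> \<ge> e \<Longrightarrow> tent_kernel e x z = 0"
  by (simp add: tent_kernel_def tent_eq_0)

lemma integral_tent_kernel:
  assumes "e > 0" "a \<le> x - e" "x + e \<le> b"
  shows "(\<integral>z. tent_kernel e x z \<partial>lebesgue_on {a<..<b}) = 1"
proof -
  have "(\<integral>z. tent_kernel e x z \<partial>lebesgue_on {a<..<b}) = integral {a<..<b} (tent_kernel e x)"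
    by (intro lebesgue_integral_eq_integral integrable_lebesgue_on_Ioo_if_continuous
        continuous_tent_kernel assms) auto
  also have "\<dots> = integral {a..b} (tent_kernel e x)"
    by (rule integral_open_interval_real[symmetric])
  also have "\<dots> = smooth_step ((b - x) / e) - smooth_step ((a - x) / e)"
    using assms
    by (intro integral_unique fundamental_theorem_of_calculus)
      (auto simp flip: has_real_derivative_iff_has_vector_derivative
        intro!: DERIV_subset[OF DERIV_scaled_step])
  also have "\<dots> = 1"
    using assms by (simp add: smooth_step_left smooth_step_right field_simps)
  finally show ?thesis .
qed

lemma tent_kernel_approximates_value:
  fixes u :: "real \<Rightarrow> real"
  assumes u: "continuous_on {a..b} u" and e: "e > 0" "a \<le> x - e" "x + e \<le> b"
    and osc: "\<And>z. \<bar>z - x\<bar> < e \<Longrightarrow> \<bar>u z - u x\<bar> \<le> d"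
  shows "\<bar>(\<integral>z. u z * tent_kernel e x z \<partial>lebesgue_on {a<..<b}) - u x\<bar> \<le> d"
proof -
  let ?M = "lebesgue_on {a<..<b}"
  have ki: "integrable ?M (tent_kernel e x)"
    by (intro integrable_lebesgue_on_Ioo_if_continuous continuous_tent_kernel e)
  have ui: "integrable ?M (\<lambda>z. u z * tent_kernel e x z)"
    by (intro integrable_lebesgue_on_Ioo_if_continuous continuous_intros continuous_tent_kernel e u)
  have "(\<integral>z. u z * tent_kernel e x z \<partial>?M) - u x
      = (\<integral>z. u z * tent_kernel e x z \<partial>?M) - u x * (\<integral>z. tent_kernel e x z \<partial>?M)"
    by (simp add: integral_tent_kernel e)
  also have "\<dots> = (\<integral>z. u z * tent_kernel e x z - u x * tent_kernel e x z \<partial>?M)"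
    using ui ki by simp
  also have "\<dots> = (\<integral>z. (u z - u x) * tent_kernel e x z \<partial>?M)"
    by (simp add: left_diff_distrib)
  also have "\<bar>\<dots>\<bar> \<le> (\<integral>z. d * tent_kernel e x z \<partial>?M)"
  proof -
    have "\<bar>(u z - u x) * tent_kernel e x z\<bar> \<le> d * tent_kernel e x z" for z
    proof (cases "\<bar>z - x\<bar> < e")
      case True
      then show ?thesis using osc[OF True] tent_kernel_nonneg[OF e(1), of x z]
        by (auto simp: abs_mult intro!: mult_right_mono)
    next
      case False
      then show ?thesis using tent_kernel_eq_0[OF e(1), of z x] by simp
    qed
    moreover have "integrable ?M (\<lambda>z. (u z - u x) * tent_kernel e x z)"
      using ui ki by (simp add: left_diff_distrib)
    ultimately have "\<bar>\<integral>z. (u z - u x) * tent_kernel e x z \<partial>?M\<bar> \<le> (\<integral>z. d * tent_kernel e x z \<partial>?M)"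
      using ki by (intro integral_abs_bound_integral) auto
    then show ?thesis by simp
  qed
  also have "\<dots> = d" by (simp add: integral_tent_kernel e)
  finally show ?thesis .
qed

section \<open>Functions with a weak derivative\<close>

text \<open>A function of \<open>H\<^sub>0\<^sup>1(0,T)\<close> is carried along with a chosen weak derivative, so that limits and
  linear combinations act on the two components at once and no representative of the derivative has
  to be selected. The square integrability of \<open>u\<close> follows from continuity on a compact interval.\<close>

definition weak_pair :: "real \<Rightarrow> (real \<Rightarrow> real) \<Rightarrow> (real \<Rightarrow> real) \<Rightarrow> bool" where
  "weak_pair T u g \<longleftrightarrow> continuous_on {0..T} u \<and> u 0 = 0 \<and> u T = 0 \<and>
     square_integrable (lebesgue_on {0<..<T}) g \<and>
     (\<forall>\<phi>. C1_compact_support {0<..<T} \<phi> \<longrightarrow>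
        (\<integral>x. u x * deriv \<phi> x \<partial>lebesgue_on {0<..<T}) = - (\<integral>x. g x * \<phi> x \<partial>lebesgue_on {0<..<T}))"

text \<open>The squared norm of \<open>H\<^sub>0\<^sup>1(0,T)\<close>, without the factor \<open>1/2\<close> of the variational functional.\<close>

definition energy :: "real \<Rightarrow> (real \<Rightarrow> real) \<Rightarrow> real" where
  "energy T g = (\<integral>x. (g x)\<^sup>2 \<partial>lebesgue_on {0<..<T})"

lemma has_weak_L2_deriv_iff:
  "has_weak_L2_deriv T u g \<longleftrightarrow> square_integrable (lebesgue_on {0<..<T}) g \<and>
     (\<forall>\<phi>. C1_compact_support {0<..<T} \<phi> \<longrightarrow>
        (\<integral>x. u x * deriv \<phi> x \<partial>lebesgue_on {0<..<T}) = - (\<integral>x. g x * \<phi> x \<partial>lebesgue_on {0<..<T}))"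
  unfolding has_weak_L2_deriv_def
  by (simp add: L2_on_iff_square_integrable set_lebesgue_integral_eq_lebesgue_on)

lemma weak_pair_iff: "weak_pair T u g \<longleftrightarrow> u \<in> H01 T \<and> has_weak_L2_deriv T u g"
  unfolding weak_pair_def H01_def has_weak_L2_deriv_iff
  using square_integrable_if_continuous[of 0 T u]
  by (auto simp: L2_on_iff_square_integrable)

lemma energy_nonneg: "energy T g \<ge> 0"
  by (simp add: energy_def)

lemma C1_compact_support_continuous:
  assumes "C1_compact_support U \<phi>"
  shows "continuous_on S \<phi>" "continuous_on S (deriv \<phi>)"
proof -
  have *: "\<phi> C1_differentiable_on UNIV" using assms by (simp add: C1_compact_support_def)
  then have "continuous_on UNIV \<phi>"
    by (simp add: C1_differentiable_imp_continuous_on)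
  then show "continuous_on S \<phi>" using continuous_on_subset by blast
  have "continuous_on UNIV (\<lambda>x. vector_derivative \<phi> (at x))"
    using * by (simp add: C1_differentiable_on_eq)
  moreover have "vector_derivative \<phi> (at x) = deriv \<phi> x" for x
  proof -
    have "\<phi> differentiable at x" using * by (simp add: C1_differentiable_on_eq)
    then have "(\<phi> has_vector_derivative vector_derivative \<phi> (at x)) (at x)"
      by (simp add: vector_derivative_works)
    then show ?thesis
      by (metis DERIV_imp_deriv has_real_derivative_iff_has_vector_derivative)
  qed
  ultimately show "continuous_on S (deriv \<phi>)" using continuous_on_subset by (simp add: continuous_on_subset[of UNIV])
qed

lemma C1_compact_support_square_integrable:
  assumes "C1_compact_support U \<phi>"
  shows "square_integrable (lebesgue_on {0<..<T}) \<phi>"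
    "square_integrable (lebesgue_on {0<..<T}) (deriv \<phi>)"
  using C1_compact_support_continuous[OF assms] square_integrable_if_continuous by blast+

lemma weak_pair_zero: "weak_pair T (\<lambda>_. 0) (\<lambda>_. 0)"
  by (simp add: weak_pair_def square_integrable_def)

lemma integral_lincomb_mult:
  assumes "square_integrable M f" "square_integrable M g" "square_integrable M h"
  shows "(\<integral>x. (a * f x + b * g x) * h x \<partial>M) = a * (\<integral>x. f x * h x \<partial>M) + b * (\<integral>x. g x * h x \<partial>M)"
proof -
  have "(\<lambda>x. (a * f x + b * g x) * h x) = (\<lambda>x. a * (f x * h x) + b * (g x * h x))"
    by (auto simp: algebra_simps)
  then show ?thesis
    using square_integrable_mult_integrable[OF assms(1,3)] square_integrable_mult_integrable[OF assms(2,3)]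
    by simp
qed

lemma weak_pair_lincomb:
  assumes u: "weak_pair T u g" and v: "weak_pair T v h"
  shows "weak_pair T (\<lambda>x. a * u x + b * v x) (\<lambda>x. a * g x + b * h x)"
proof -
  have cu: "continuous_on {0..T} u" and cv: "continuous_on {0..T} v"
    and sg: "square_integrable (lebesgue_on {0<..<T}) g" and sh: "square_integrable (lebesgue_on {0<..<T}) h"
    using u v by (auto simp: weak_pair_def)
  have "(\<integral>x. (a * u x + b * v x) * deriv \<phi> x \<partial>lebesgue_on {0<..<T})
     = - (\<integral>x. (a * g x + b * h x) * \<phi> x \<partial>lebesgue_on {0<..<T})"
    if "C1_compact_support {0<..<T} \<phi>" for \<phi>
  proof -
    note \<phi> = C1_compact_support_square_integrable[OF that, of T]
    have "(\<integral>x. u x * deriv \<phi> x \<partial>lebesgue_on {0<..<T}) = - (\<integral>x. g x * \<phi> x \<partial>lebesgue_on {0<..<T})"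
      "(\<integral>x. v x * deriv \<phi> x \<partial>lebesgue_on {0<..<T}) = - (\<integral>x. h x * \<phi> x \<partial>lebesgue_on {0<..<T})"
      using u v that unfolding weak_pair_def by blast+
    then show ?thesis
      by (simp add: integral_lincomb_mult[OF square_integrable_if_continuous[OF cu]
        square_integrable_if_continuous[OF cv] \<phi>(2)] integral_lincomb_mult[OF sg sh \<phi>(1)])
  qed
  then show ?thesis using assms unfolding weak_pair_def
    by (auto intro!: continuous_intros square_integrable_lincomb)
qed

text \<open>Testing against a smoothed indicator of \<open>[x, y]\<close> turns the left-hand side of the weak identity
  into a difference of local averages of \<open>u\<close> near \<open>x\<close> and near \<open>y\<close>, each within \<open>d\<close> of the value of
  \<open>u\<close>, while the Cauchy--Schwarz inequality bounds the other side by the norm of the derivative times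
  the root of the length of the support.\<close>

lemma weak_pair_increment_bound_approx:
  assumes u: "weak_pair T u g" and xy: "x \<le> y" and e: "e > 0" "0 < x - e" "y + e < T"
    and osc: "\<And>z w. w \<in> {x, y} \<Longrightarrow> \<bar>z - w\<bar> < e \<Longrightarrow> \<bar>u z - u w\<bar> \<le> d"
  shows "\<bar>u x - u y\<bar> \<le> 2 * d + sqrt (energy T g) * sqrt (y - x + 2 * e)"
proof -
  let ?M = "lebesgue_on {0<..<T}"
  have cu: "continuous_on {0..T} u" and sg: "square_integrable ?M g"
    using u by (auto simp: weak_pair_def)
  define \<phi> where "\<phi> z = smooth_step ((z - x) / e) - smooth_step ((z - y) / e)" for z
  have D\<phi>: "(\<phi> has_real_derivative tent_kernel e x z - tent_kernel e y z) (at z)" for z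
    unfolding \<phi>_def[abs_def] by (intro DERIV_diff DERIV_scaled_step e)
  have d\<phi>: "deriv \<phi> z = tent_kernel e x z - tent_kernel e y z" for z
    by (rule DERIV_imp_deriv[OF D\<phi>])
  have supp: "\<phi> z = 0" if "z \<notin> {x - e..y + e}" for z
  proof (cases "z < x - e")
    case True
    then have "(z - x) / e \<le> -1" "(z - y) / e \<le> -1" using e xy by (auto simp: field_simps)
    then show ?thesis by (simp add: \<phi>_def smooth_step_left)
  next
    case False
    then have "(z - x) / e \<ge> 1" "(z - y) / e \<ge> 1" using that e xy by (auto simp: field_simps)
    then show ?thesis by (simp add: \<phi>_def smooth_step_right)
  qed
  have C1: "C1_compact_support {0<..<T} \<phi>"
    unfolding C1_compact_support_def C1_differentiable_on_def
  proof (intro conjI exI[of _ "\<lambda>z. tent_kernel e x z - tent_kernel e y z"] exI[of _ "{x - e..y + e}"] ballI allI impI)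
    show "(\<phi> has_vector_derivative tent_kernel e x z - tent_kernel e y z) (at z)" for z
      using D\<phi> by (simp add: has_real_derivative_iff_has_vector_derivative)
    show "continuous_on UNIV (\<lambda>z. tent_kernel e x z - tent_kernel e y z)"
      by (intro continuous_intros continuous_tent_kernel e)
  qed (use e supp in auto)
  have k: "square_integrable ?M (tent_kernel e w)" for w
    by (intro square_integrable_if_continuous continuous_tent_kernel e)
  have su: "square_integrable ?M u" by (rule square_integrable_if_continuous[OF cu])
  have "(\<integral>z. u z * tent_kernel e x z \<partial>?M) - (\<integral>z. u z * tent_kernel e y z \<partial>?M)
      = (\<integral>z. u z * deriv \<phi> z \<partial>?M)"
    using square_integrable_mult_integrable[OF su k] by (simp add: d\<phi> right_diff_distrib)
  also have "\<dots> = - (\<integral>z. g z * \<phi> z \<partial>?M)"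
    using u C1 by (simp add: weak_pair_def)
  finally have weak: "(\<integral>z. u z * tent_kernel e x z \<partial>?M) - (\<integral>z. u z * tent_kernel e y z \<partial>?M)
     = - (\<integral>z. g z * \<phi> z \<partial>?M)" .
  have ax: "\<bar>(\<integral>z. u z * tent_kernel e x z \<partial>?M) - u x\<bar> \<le> d"
    by (rule tent_kernel_approximates_value[OF cu]) (use e xy osc[of x] in auto)
  have ay: "\<bar>(\<integral>z. u z * tent_kernel e y z \<partial>?M) - u y\<bar> \<le> d"
    by (rule tent_kernel_approximates_value[OF cu]) (use e xy osc[of y] in auto)
  note s\<phi> = C1_compact_support_square_integrable(1)[OF C1, of T]
  have "(\<integral>z. (\<phi> z)\<^sup>2 \<partial>?M) \<le> (\<integral>z. indicator {x - e..y + e} z \<partial>?M)"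
  proof (rule integral_mono)
    show "integrable ?M (\<lambda>z. (\<phi> z)\<^sup>2)" using s\<phi> by (simp add: square_integrable_def)
    show "integrable ?M (indicator {x - e..y + e} :: real \<Rightarrow> real)"
      by (rule integrable_lebesgue_on_subset[of UNIV])
        (auto simp: lebesgue_on_UNIV_eq lmeasurable_iff_integrable[symmetric])
    fix z
    have "\<bar>\<phi> z\<bar> \<le> 1"
      unfolding \<phi>_def using smooth_step_bounds[of "(z - x) / e"] smooth_step_bounds[of "(z - y) / e"] by linarith
    then have "(\<phi> z)\<^sup>2 \<le> 1" by (simp add: abs_square_le_1)
    then show "(\<phi> z)\<^sup>2 \<le> indicator {x - e..y + e} z"
      using supp[of z] by (cases "z \<in> {x - e..y + e}") auto
  qed
  also have "\<dots> = y - x + 2 * e"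
  proof -
    have "(\<integral>z. indicat_real {x - e..y + e} z \<partial>?M)
        = (\<integral>z. indicator {0<..<T} z *\<^sub>R indicat_real {x - e..y + e} z \<partial>lebesgue)"
      by (rule integral_restrict_space) auto
    also have "\<dots> = (\<integral>z. indicat_real {x - e..y + e} z \<partial>lebesgue)"
      using e by (intro Bochner_Integration.integral_cong refl) (auto simp: indicator_def)
    also have "\<dots> = measure lebesgue {x - e..y + e}"
      by simp
    also have "\<dots> = y - x + 2 * e" using e xy by simp
    finally show ?thesis .
  qed
  finally have n\<phi>: "(\<integral>z. (\<phi> z)\<^sup>2 \<partial>?M) \<le> y - x + 2 * e" .
  have "\<bar>\<integral>z. g z * \<phi> z \<partial>?M\<bar> \<le> sqrt (energy T g) * sqrt (\<integral>z. (\<phi> z)\<^sup>2 \<partial>?M)"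
    unfolding energy_def by (rule integral_Cauchy_Schwarz[OF sg s\<phi>])
  also have "\<dots> \<le> sqrt (energy T g) * sqrt (y - x + 2 * e)"
    using n\<phi> by (intro mult_left_mono real_sqrt_le_mono) (auto simp: energy_nonneg)
  finally show ?thesis using weak ax ay by linarith
qed

text \<open>The width \<open>e\<close> of the smoothed indicator tends to \<open>0\<close> first, and then the oscillation \<open>d\<close> of
  \<open>u\<close>, which continuity makes arbitrarily small.\<close>

lemma weak_pair_Hoelder_interior:
  assumes u: "weak_pair T u g" and xy: "0 < x" "x \<le> y" "y < T"
  shows "\<bar>u x - u y\<bar> \<le> sqrt (energy T g) * sqrt (y - x)"
proof (rule field_le_epsilon)
  fix d :: real assume "d > 0"
  have cu: "continuous_on {0<..<T} u"
    using u by (auto simp: weak_pair_def intro: continuous_on_subset)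
  have near: "\<forall>\<^sub>F e in at_right 0. \<forall>z. \<bar>z - w\<bar> < e \<longrightarrow> \<bar>u z - u w\<bar> \<le> d / 2" if "w \<in> {0<..<T}" for w
  proof -
    have "isCont u w" using cu that by (simp add: continuous_on_eq_continuous_at)
    then obtain s where s: "s > 0" "\<And>z. \<bar>z - w\<bar> < s \<Longrightarrow> \<bar>u z - u w\<bar> < d / 2"
      using \<open>d > 0\<close> unfolding continuous_at_eps_delta dist_real_def by (meson half_gt_zero)
    show ?thesis
      using eventually_at_right_real[OF \<open>s > 0\<close>] 
    proof eventually_elim
      case (elim e)
      show ?case
      proof (intro allI impI less_imp_le[OF s(2)])
        show "\<bar>z - w\<bar> < s" if "\<bar>z - w\<bar> < e" for z using that elim by simp
      qed
    qed
  qed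
  have x: "x \<in> {0<..<T}" and y: "y \<in> {0<..<T}" using xy by auto
  have "\<forall>\<^sub>F e in at_right 0. e \<in> {0<..<min x (T - y)}"
    by (rule eventually_at_right_real) (use xy in simp)
  with near[OF x] near[OF y]
  have "\<forall>\<^sub>F e in at_right 0. \<bar>u x - u y\<bar> \<le> 2 * (d / 2) + sqrt (energy T g) * sqrt (y - x + 2 * e)"
  proof eventually_elim
    case (elim e)
    show ?case
      by (rule weak_pair_increment_bound_approx[OF u xy(2)]) (use elim in auto)
  qed
  moreover have "((\<lambda>e. 2 * (d / 2) + sqrt (energy T g) * sqrt (y - x + 2 * e)) \<longlongrightarrow>
     2 * (d / 2) + sqrt (energy T g) * sqrt (y - x + 2 * 0)) (at_right 0)"
    by (intro tendsto_intros)
  ultimately have "\<bar>u x - u y\<bar> \<le> 2 * (d / 2) + sqrt (energy T g) * sqrt (y - x + 2 * 0)"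
    by (intro tendsto_lowerbound) auto
  then show "\<bar>u x - u y\<bar> \<le> sqrt (energy T g) * sqrt (y - x) + d" by simp
qed

text \<open>The one-dimensional Sobolev inequality. Moving both points towards the midpoint \<open>T/2\<close> reduces
  it to interior points, by continuity of \<open>u\<close> up to the boundary. It is the only link between the
  energy and pointwise values: it supplies the equicontinuity for the compactness argument and the
  bound on the increments that enter the nonlinearity.\<close>

lemma weak_pair_Hoelder:
  assumes u: "weak_pair T u g" and T: "T > 0" and xy: "x \<in> {0..T}" "y \<in> {0..T}"
  shows "\<bar>u x - u y\<bar> \<le> sqrt (energy T g) * sqrt \<bar>x - y\<bar>"
proof -
  define c where "c x n = x + (T / 2 - x) * (1 / real (Suc n))" for x n
  have c_lim: "c x \<longlonglongrightarrow> x" for x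
  proof -
    have "(\<lambda>n. x + (T / 2 - x) * (1 / real (Suc n))) \<longlonglongrightarrow> x + (T / 2 - x) * 0"
      by (intro tendsto_intros LIMSEQ_inverse_real_of_nat[unfolded inverse_eq_divide])
    then show ?thesis by (simp add: c_def[abs_def])
  qed
  have c_in: "c x n \<in> {0<..<T}" if "x \<in> {0..T}" for x n
  proof -
    define l where "l = 1 / real (Suc n)"
    have l: "0 < l" "l \<le> 1" by (auto simp: l_def)
    have eq: "c x n = (1 - l) * x + l * (T / 2)" unfolding c_def l_def[symmetric] by (simp add: algebra_simps)
    have "0 \<le> (1 - l) * x" using l that by auto
    moreover have "0 < l * (T / 2)" using l T by simp
    moreover have "(1 - l) * x \<le> (1 - l) * T" using l that by (intro mult_left_mono) auto
    moreover have "(1 - l) * T + l * (T / 2) = T - l * (T / 2)" by (simp add: algebra_simps)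
    ultimately show ?thesis unfolding eq by simp
  qed
  have u_lim: "(\<lambda>n. u (c x n)) \<longlonglongrightarrow> u x" if "x \<in> {0..T}" for x
  proof -
    have "continuous_on {0..T} u" using u by (simp add: weak_pair_def)
    then show ?thesis
      by (rule continuous_on_tendsto_compose[OF _ c_lim that])
        (use c_in[OF that] in \<open>auto intro!: always_eventually less_imp_le\<close>)
  qed
  have int: "\<bar>u (c x n) - u (c y n)\<bar> \<le> sqrt (energy T g) * sqrt \<bar>c x n - c y n\<bar>" for n
  proof (cases "c x n \<le> c y n")
    case True
    then show ?thesis using weak_pair_Hoelder_interior[OF u _ True] c_in[OF xy(1)] c_in[OF xy(2)] by simp
  next
    case False
    then show ?thesis using weak_pair_Hoelder_interior[OF u, of "c y n" "c x n"] c_in[OF xy(1)] c_in[OF xy(2)]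
      by (simp add: abs_minus_commute)
  qed
  show ?thesis
  proof (rule LIMSEQ_le)
    show "(\<lambda>n. \<bar>u (c x n) - u (c y n)\<bar>) \<longlonglongrightarrow> \<bar>u x - u y\<bar>"
      by (intro tendsto_intros u_lim xy)
    show "(\<lambda>n. sqrt (energy T g) * sqrt \<bar>c x n - c y n\<bar>) \<longlonglongrightarrow> sqrt (energy T g) * sqrt \<bar>x - y\<bar>"
      by (intro tendsto_intros c_lim)
  qed (use int in blast)
qed

lemma L2_tendsto_integral_mult:
  assumes h: "square_integrable M h" and g: "\<And>n. square_integrable M (g n)" and f: "square_integrable M f"
    and lim: "(\<lambda>n. \<integral>x. (h x - g n x)\<^sup>2 \<partial>M) \<longlonglongrightarrow> 0"
  shows "(\<lambda>n. \<integral>x. g n x * f x \<partial>M) \<longlonglongrightarrow> (\<integral>x. h x * f x \<partial>M)"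
proof (rule LIM_zero_cancel, rule tendsto_rabs_zero_cancel, rule tendsto_sandwich[of "\<lambda>_. 0"])
  show "(\<lambda>n. sqrt (\<integral>x. (h x - g n x)\<^sup>2 \<partial>M) * sqrt (\<integral>x. (f x)\<^sup>2 \<partial>M)) \<longlonglongrightarrow> 0"
    using tendsto_mult_right[OF tendsto_real_sqrt[OF lim], of "sqrt (\<integral>x. (f x)\<^sup>2 \<partial>M)"] by simp
  have "\<bar>(\<integral>x. g n x * f x \<partial>M) - (\<integral>x. h x * f x \<partial>M)\<bar>
      \<le> sqrt (\<integral>x. (h x - g n x)\<^sup>2 \<partial>M) * sqrt (\<integral>x. (f x)\<^sup>2 \<partial>M)" for n
  proof -
    have s: "square_integrable M (\<lambda>x. h x - g n x)"
      using square_integrable_lincomb[OF h g[of n], of 1 "-1"] by simp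
    show ?thesis using integral_Cauchy_Schwarz[OF s f] integral_lincomb_mult[OF h g[of n] f, of 1 "-1"]
      by simp
  qed
  then show "\<forall>\<^sub>F n in sequentially. \<bar>(\<integral>x. g n x * f x \<partial>M) - (\<integral>x. h x * f x \<partial>M)\<bar>
      \<le> sqrt (\<integral>x. (h x - g n x)\<^sup>2 \<partial>M) * sqrt (\<integral>x. (f x)\<^sup>2 \<partial>M)" by simp
qed auto

lemma L2_tendsto_norm:
  assumes h: "square_integrable M h" and g: "\<And>n. square_integrable M (g n)"
    and lim: "(\<lambda>n. \<integral>x. (h x - g n x)\<^sup>2 \<partial>M) \<longlonglongrightarrow> 0"
  shows "(\<lambda>n. \<integral>x. (g n x)\<^sup>2 \<partial>M) \<longlonglongrightarrow> (\<integral>x. (h x)\<^sup>2 \<partial>M)"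
proof -
  have "(\<integral>x. (g n x)\<^sup>2 \<partial>M) = (\<integral>x. (h x - g n x)\<^sup>2 \<partial>M) - (\<integral>x. (h x)\<^sup>2 \<partial>M) + 2 * (\<integral>x. g n x * h x \<partial>M)" for n
    using integral_lincomb_square[OF h g[of n], of 1 "-1"] by (simp add: mult.commute)
  moreover have "(\<lambda>n. (\<integral>x. (h x - g n x)\<^sup>2 \<partial>M) - (\<integral>x. (h x)\<^sup>2 \<partial>M) + 2 * (\<integral>x. g n x * h x \<partial>M))
     \<longlonglongrightarrow> 0 - (\<integral>x. (h x)\<^sup>2 \<partial>M) + 2 * (\<integral>x. h x * h x \<partial>M)"
    by (intro tendsto_intros lim L2_tendsto_integral_mult h g)
  ultimately show ?thesis by (simp add: power2_eq_square)
qed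

text \<open>Both sides of the defining identity pass to the limit, the left one by dominated convergence.\<close>

lemma weak_pair_limit:
  assumes w: "\<And>n. weak_pair T (u n) (g n)"
    and u_lim: "uniform_limit {0..T} u v sequentially"
    and h: "square_integrable (lebesgue_on {0<..<T}) h"
    and g_lim: "(\<lambda>n. \<integral>x. (h x - g n x)\<^sup>2 \<partial>lebesgue_on {0<..<T}) \<longlonglongrightarrow> 0"
    and T: "T > 0"
  shows "weak_pair T v h"
proof -
  let ?M = "lebesgue_on {0<..<T}"
  have cv: "continuous_on {0..T} v"
    by (rule uniform_limit_theorem[OF _ u_lim]) (use w in \<open>auto simp: weak_pair_def\<close>)
  have pt: "(\<lambda>n. u n x) \<longlonglongrightarrow> v x" if "x \<in> {0..T}" for x
    using u_lim that by (rule tendsto_uniform_limitI)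
  have bc: "v 0 = 0" "v T = 0"
    using LIMSEQ_unique[OF pt[of 0]] LIMSEQ_unique[OF pt[of T]] w T by (auto simp: weak_pair_def)
  have weak: "(\<integral>x. v x * deriv \<phi> x \<partial>?M) = - (\<integral>x. h x * \<phi> x \<partial>?M)"
    if \<phi>: "C1_compact_support {0<..<T} \<phi>" for \<phi>
  proof (rule LIMSEQ_unique)
    note s\<phi> = C1_compact_support_square_integrable[OF \<phi>, of T]
    have "(\<lambda>n. - (\<integral>x. g n x * \<phi> x \<partial>?M)) \<longlonglongrightarrow> - (\<integral>x. h x * \<phi> x \<partial>?M)"
      by (intro tendsto_minus L2_tendsto_integral_mult h s\<phi> g_lim) (use w in \<open>auto simp: weak_pair_def\<close>)
    then show "(\<lambda>n. \<integral>x. u n x * deriv \<phi> x \<partial>?M) \<longlonglongrightarrow> - (\<integral>x. h x * \<phi> x \<partial>?M)"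
      using w \<phi> by (simp add: weak_pair_def)
    have "\<forall>\<^sub>F n in sequentially. \<forall>x\<in>{0..T}. dist (u n x) (v x) < 1"
      using u_lim by (rule uniform_limitD) simp
    then obtain n0 where n0: "\<And>n x. n \<ge> n0 \<Longrightarrow> x \<in> {0..T} \<Longrightarrow> \<bar>u n x - v x\<bar> < 1"
      unfolding eventually_sequentially dist_real_def by blast
    have cd: "continuous_on {0..T} (deriv \<phi>)" by (rule C1_compact_support_continuous[OF \<phi>])
    have "(\<lambda>n. \<integral>x. u (n + n0) x * deriv \<phi> x \<partial>?M) \<longlonglongrightarrow> (\<integral>x. v x * deriv \<phi> x \<partial>?M)"
    proof (rule integral_dominated_convergence)
      show "(\<lambda>x. v x * deriv \<phi> x) \<in> borel_measurable ?M"
        by (rule borel_measurable_integrable)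
          (intro integrable_lebesgue_on_Ioo_if_continuous continuous_intros cv cd)
      show "(\<lambda>x. u (n + n0) x * deriv \<phi> x) \<in> borel_measurable ?M" for n
        by (rule borel_measurable_integrable)
          (use w cd in \<open>auto simp: weak_pair_def intro!: integrable_lebesgue_on_Ioo_if_continuous continuous_intros\<close>)
      show "integrable ?M (\<lambda>x. (\<bar>v x\<bar> + 1) * \<bar>deriv \<phi> x\<bar>)"
        by (intro integrable_lebesgue_on_Ioo_if_continuous continuous_intros cv cd)
      show "AE x in ?M. (\<lambda>n. u (n + n0) x * deriv \<phi> x) \<longlonglongrightarrow> v x * deriv \<phi> x"
        by (rule AE_I2) (auto intro!: tendsto_intros LIMSEQ_ignore_initial_segment pt)
      show "AE x in ?M. norm (u (n + n0) x * deriv \<phi> x) \<le> (\<bar>v x\<bar> + 1) * \<bar>deriv \<phi> x\<bar>" for n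
      proof (rule AE_I2)
        fix x assume "x \<in> space ?M"
        then have "\<bar>u (n + n0) x - v x\<bar> < 1" using n0[of "n + n0" x] by auto
        then have "\<bar>u (n + n0) x\<bar> \<le> \<bar>v x\<bar> + 1" by linarith
        then show "norm (u (n + n0) x * deriv \<phi> x) \<le> (\<bar>v x\<bar> + 1) * \<bar>deriv \<phi> x\<bar>"
          by (simp add: abs_mult mult_right_mono)
      qed
    qed
    then show "(\<lambda>n. \<integral>x. u n x * deriv \<phi> x \<partial>?M) \<longlonglongrightarrow> (\<integral>x. v x * deriv \<phi> x \<partial>?M)"
      by (rule LIMSEQ_offset)
  qed
  show ?thesis unfolding weak_pair_def using cv bc h weak by blast
qed

section \<open>Minimisation over balls\<close>

lemma energy_midpoint:
  assumes "weak_pair T u g" "weak_pair T v h"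
  shows "energy T (\<lambda>x. 1/2 * g x + 1/2 * h x)
    = energy T g / 2 + energy T h / 2 - energy T (\<lambda>x. g x - h x) / 4"
proof -
  have "square_integrable (lebesgue_on {0<..<T}) g" "square_integrable (lebesgue_on {0<..<T}) h"
    using assms by (auto simp: weak_pair_def)
  from integral_lincomb_square[OF this, of "1/2" "1/2"] integral_lincomb_square[OF this, of 1 "-1"]
  show ?thesis by (simp add: energy_def power2_eq_square field_simps)
qed

lemma weak_pair_uniformly_convergent_subsequence:
  assumes T: "T > 0" and w: "\<And>n. weak_pair T (u n) (g n)" and R: "\<And>n. energy T (g n) \<le> R"
  obtains v k where "continuous_on {0..T} v" "strict_mono (k :: nat \<Rightarrow> nat)"
    "uniform_limit {0..T} (\<lambda>n. u (k n)) v sequentially"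
proof -
  have H: "\<bar>u n x - u n y\<bar> \<le> sqrt R * sqrt \<bar>x - y\<bar>" if "x \<in> {0..T}" "y \<in> {0..T}" for n x y
    using weak_pair_Hoelder[OF w T that, of n] R[of n]
    by (meson mult_right_mono order_trans real_sqrt_ge_zero abs_ge_zero real_sqrt_le_mono)
  have R0: "R \<ge> 0" using R[of 0] energy_nonneg[of T "g 0"] by linarith
  show ?thesis
  proof (rule Arzela_Ascoli[of "{0..T}" u "sqrt R * sqrt T"])
    show "norm (u n x) \<le> sqrt R * sqrt T" if "x \<in> {0..T}" for n x
    proof -
      have "u n 0 = 0" using w by (simp add: weak_pair_def)
      then have "\<bar>u n x\<bar> \<le> sqrt R * sqrt \<bar>x - 0\<bar>" using H[of x 0 n] that T by simp
      also have "\<dots> \<le> sqrt R * sqrt T" using that R0 by (intro mult_left_mono real_sqrt_le_mono) auto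
      finally show ?thesis by simp
    qed
    show "\<exists>d>0. \<forall>n y. y \<in> {0..T} \<and> norm (x - y) < d \<longrightarrow> norm (u n x - u n y) < e"
      if x: "x \<in> {0..T}" and e: "0 < e" for x e
    proof (intro exI[of _ "(e / (sqrt R + 1))\<^sup>2"] conjI allI impI)
      have p: "sqrt R + 1 > 0" using R0 by (simp add: add_nonneg_pos)
      then show "0 < (e / (sqrt R + 1))\<^sup>2" using e by simp
      fix n y assume y: "y \<in> {0..T} \<and> norm (x - y) < (e / (sqrt R + 1))\<^sup>2"
      then have "sqrt \<bar>x - y\<bar> < sqrt ((e / (sqrt R + 1))\<^sup>2)" by (intro real_sqrt_less_mono) simp
      also have "\<dots> = e / (sqrt R + 1)" using e p by simp
      finally have "sqrt \<bar>x - y\<bar> * (sqrt R + 1) < e" using p by (simp add: pos_less_divide_eq)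
      moreover have "sqrt R * sqrt \<bar>x - y\<bar> \<le> sqrt \<bar>x - y\<bar> * (sqrt R + 1)" by (simp add: algebra_simps)
      moreover have "\<bar>u n x - u n y\<bar> \<le> sqrt R * sqrt \<bar>x - y\<bar>" using H x y by blast
      ultimately show "norm (u n x - u n y) < e" by simp
    qed
    fix v k assume v: "continuous_on {0..T} v" and k: "strict_mono (k :: nat \<Rightarrow> nat)"
      and lim: "\<And>e. 0 < e \<Longrightarrow> \<exists>N. \<forall>n x. N \<le> n \<and> x \<in> {0..T} \<longrightarrow> norm (u (k n) x - v x) < e"
    have "uniform_limit {0..T} (\<lambda>n. u (k n)) v sequentially"
    proof (rule uniform_limitI)
      fix e :: real assume "e > 0"
      from lim[OF this] show "\<forall>\<^sub>F n in sequentially. \<forall>x\<in>{0..T}. dist (u (k n) x) (v x) < e"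
        unfolding eventually_sequentially dist_norm by blast
    qed
    with v k show ?thesis by (rule that)
  qed auto
qed

text \<open>A minimising sequence has a uniformly convergent subsequence \<open>u\<^sub>n\<close>, along which \<open>G\<close> converges.
  Weak compactness of the derivatives is replaced by uniform convexity: midpoints of \<open>u\<^sub>m\<close> and \<open>u\<^sub>n\<close>
  stay in the ball, so they have a value at least the infimum, and in the parallelogram identity
  \<open>energy (g\<^sub>m - g\<^sub>n) / 8\<close> equals the average of the two functional values minus the value at the
  midpoint, up to differences of values of \<open>G\<close> that vanish in the limit. Hence the derivatives form a
  Cauchy sequence in the mean square and the limit is attained strongly.

  Continuity of \<open>G\<close> is required at every uniform limit \<open>v\<close>, because the weak differentiability of \<open>v\<close>
  is only obtained at the end of this argument.\<close>

theorem weak_pair_ball_minimizer: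
  assumes T: "T > 0" and R: "R \<ge> 0"
    and G_bound: "\<And>u g. weak_pair T u g \<Longrightarrow> energy T g \<le> R \<Longrightarrow> G u \<le> K"
    and G_cont: "\<And>u g v. (\<And>n. weak_pair T (u n) (g n)) \<Longrightarrow> (\<And>n. energy T (g n) \<le> R) \<Longrightarrow>
       continuous_on {0..T} v \<Longrightarrow> uniform_limit {0..T} u v sequentially \<Longrightarrow> (\<lambda>n. G (u n)) \<longlonglongrightarrow> G v"
  shows "\<exists>u g. weak_pair T u g \<and> energy T g \<le> R \<and>
    (\<forall>v h. weak_pair T v h \<longrightarrow> energy T h \<le> R \<longrightarrow> energy T g / 2 - G u \<le> energy T h / 2 - G v)"
proof -
  define V where "V = {energy T g / 2 - G u | u g. weak_pair T u g \<and> energy T g \<le> R}"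
  define I where "I = Inf V"
  have "energy T (\<lambda>_. 0) / 2 - G (\<lambda>_. 0) \<in> V"
    unfolding V_def using weak_pair_zero[of T] R
    by (intro CollectI exI[of _ "\<lambda>_. 0"]) (auto simp: energy_def)
  then have Vne: "V \<noteq> {}" by blast
  have "- K \<le> energy T g / 2 - G u" if "weak_pair T u g" "energy T g \<le> R" for u g
    using G_bound[OF that] energy_nonneg[of T g] by linarith
  then have Vbdd: "bdd_below V" unfolding V_def by (intro bdd_belowI[of _ "-K"]) blast
  have I_le: "I \<le> energy T g / 2 - G u" if "weak_pair T u g" "energy T g \<le> R" for u g
    unfolding I_def using that by (intro cInf_lower Vbdd) (auto simp: V_def)
  have "\<forall>n. \<exists>u g. weak_pair T u g \<and> energy T g \<le> R \<and> energy T g / 2 - G u < I + inverse (real (Suc n))"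
  proof
    fix n
    have "Inf V < I + inverse (real (Suc n))" unfolding I_def by simp
    from cInf_lessD[OF Vne this] show "\<exists>u g. weak_pair T u g \<and> energy T g \<le> R \<and> energy T g / 2 - G u < I + inverse (real (Suc n))"
      unfolding V_def by blast
  qed
  then obtain u0 g0 where w0: "\<And>n. weak_pair T (u0 n) (g0 n)" and R0: "\<And>n. energy T (g0 n) \<le> R"
    and min0: "\<And>n. energy T (g0 n) / 2 - G (u0 n) < I + inverse (real (Suc n))"
    by metis
  obtain v k where v: "continuous_on {0..T} v" and k: "strict_mono (k :: nat \<Rightarrow> nat)"
    and lim0: "uniform_limit {0..T} (\<lambda>n. u0 (k n)) v sequentially"
    by (rule weak_pair_uniformly_convergent_subsequence[of T u0 g0 R]) (use T w0 R0 in auto)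
  define u g where "u n = u0 (k n)" and "g n = g0 (k n)" for n
  have w: "weak_pair T (u n) (g n)" and gR: "energy T (g n) \<le> R" for n
    using w0 R0 by (auto simp: u_def g_def)
  have lim: "uniform_limit {0..T} u v sequentially"
    using lim0 unfolding u_def[abs_def] .
  have sg: "square_integrable (lebesgue_on {0<..<T}) (g n)" for n
    using w by (simp add: weak_pair_def)
  have \<phi>_lim: "(\<lambda>n. energy T (g n) / 2 - G (u n)) \<longlonglongrightarrow> I"
  proof (rule tendsto_sandwich[of "\<lambda>_. I"])
    show "(\<lambda>n. I + inverse (real (Suc n))) \<longlonglongrightarrow> I"
      by (rule LIMSEQ_inverse_real_of_nat_add)
    have "energy T (g n) / 2 - G (u n) \<le> I + inverse (real (Suc n))" for n
    proof -
      have "inverse (real (Suc (k n))) \<le> inverse (real (Suc n))"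
        using seq_suble[OF k, of n] by (intro le_imp_inverse_le) auto
      then show ?thesis using min0[of "k n"] unfolding u_def g_def by linarith
    qed
    then show "\<forall>\<^sub>F n in sequentially. energy T (g n) / 2 - G (u n) \<le> I + inverse (real (Suc n))"
      by simp
    show "\<forall>\<^sub>F n in sequentially. I \<le> energy T (g n) / 2 - G (u n)"
      using I_le[OF w gR] by simp
  qed simp
  have G_lim: "(\<lambda>n. G (u n)) \<longlonglongrightarrow> G v"
    by (rule G_cont[OF w gR v lim])
  define mid where "mid m n = (\<lambda>x. 1/2 * u m x + 1/2 * u n x)" for m n
  have wmid: "weak_pair T (mid m n) (\<lambda>x. 1/2 * g m x + 1/2 * g n x)" for m n
    unfolding mid_def by (rule weak_pair_lincomb[OF w w])
  have Rmid: "energy T (\<lambda>x. 1/2 * g m x + 1/2 * g n x) \<le> R" for m n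
    using energy_midpoint[OF w[of m] w[of n]] gR[of m] gR[of n]
      energy_nonneg[of T "\<lambda>x. g m x - g n x"] by linarith
  \<comment> \<open>Convergence at the midpoints is uniform in both indices, since otherwise index sequences tending
    to infinity would contradict sequential continuity.\<close>
  have G_mid: "\<exists>n0. \<forall>m\<ge>n0. \<forall>n\<ge>n0. \<bar>G (mid m n) - G v\<bar> < e" if "e > 0" for e
  proof (rule ccontr)
    assume "\<not> ?thesis"
    then have "\<forall>j. \<exists>m n. m \<ge> j \<and> n \<ge> j \<and> \<bar>G (mid m n) - G v\<bar> \<ge> e"
      by (meson not_less)
    then obtain a b where ab: "\<And>j. a j \<ge> j" "\<And>j. b j \<ge> j" "\<And>j. \<bar>G (mid (a j) (b j)) - G v\<bar> \<ge> e"
      by metis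
    have "uniform_limit {0..T} (\<lambda>j. mid (a j) (b j)) v sequentially"
    proof (rule uniform_limitI)
      fix d :: real assume "d > 0"
      then have "\<forall>\<^sub>F n in sequentially. \<forall>x\<in>{0..T}. dist (u n x) (v x) < d"
        using lim by (rule uniform_limitD[rotated])
      then obtain n0 where n0: "\<And>n x. n \<ge> n0 \<Longrightarrow> x \<in> {0..T} \<Longrightarrow> \<bar>u n x - v x\<bar> < d"
        unfolding eventually_sequentially dist_real_def by blast
      have "dist (mid (a j) (b j) x) (v x) < d" if "j \<ge> n0" "x \<in> {0..T}" for j x
      proof -
        have "\<bar>u (a j) x - v x\<bar> < d" "\<bar>u (b j) x - v x\<bar> < d"
          using n0 that ab le_trans by blast+
        then show ?thesis unfolding mid_def dist_real_def by linarith
      qed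
      then show "\<forall>\<^sub>F j in sequentially. \<forall>x\<in>{0..T}. dist (mid (a j) (b j) x) (v x) < d"
        unfolding eventually_sequentially by blast
    qed
    from G_cont[OF wmid Rmid v this] have "(\<lambda>j. G (mid (a j) (b j))) \<longlonglongrightarrow> G v" .
    from LIMSEQ_D[OF this \<open>e > 0\<close>] obtain j where "\<bar>G (mid (a j) (b j)) - G v\<bar> < e"
      by auto
    with ab(3)[of j] show False by linarith
  qed
  have Cauchy: "\<exists>n0. \<forall>m\<ge>n0. \<forall>n\<ge>n0. (\<integral>x. (g m x - g n x)\<^sup>2 \<partial>lebesgue_on {0<..<T}) \<le> e" if e: "e > 0" for e
  proof -
    \<comment> \<open>The parallelogram identity multiplies the value differences by \<open>8\<close>; the
      differences enter with weights of sum \<open>3\<close>, so \<open>e / 32\<close> suffices.\<close>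
    have e8: "e / 32 > 0" using e by simp
    obtain n1 where n1: "\<And>m n. m \<ge> n1 \<Longrightarrow> n \<ge> n1 \<Longrightarrow> \<bar>G (mid m n) - G v\<bar> < e / 32"
      using G_mid[OF e8] by blast
    obtain n2 where n2: "\<And>n. n \<ge> n2 \<Longrightarrow> \<bar>G (u n) - G v\<bar> < e / 32"
      using LIMSEQ_D[OF G_lim e8] by auto
    obtain n3 where n3: "\<And>n. n \<ge> n3 \<Longrightarrow> \<bar>energy T (g n) / 2 - G (u n) - I\<bar> < e / 32"
      using LIMSEQ_D[OF \<phi>_lim e8] by auto
    have "(\<integral>x. (g m x - g n x)\<^sup>2 \<partial>lebesgue_on {0<..<T}) \<le> e" if "m \<ge> n1 + n2 + n3" "n \<ge> n1 + n2 + n3" for m n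
    proof -
      have "energy T (\<lambda>x. g m x - g n x) \<le> e"
      proof -
        have "\<bar>G (mid m n) - G v\<bar> < e / 32" "\<bar>G (u m) - G v\<bar> < e / 32" "\<bar>G (u n) - G v\<bar> < e / 32"
          "\<bar>energy T (g m) / 2 - G (u m) - I\<bar> < e / 32" "\<bar>energy T (g n) / 2 - G (u n) - I\<bar> < e / 32"
          by (intro n1 n2 n3; use that in linarith)+
        then show ?thesis
          using energy_midpoint[OF w[of m] w[of n]] I_le[OF wmid Rmid, of m n] by linarith
      qed
      then show ?thesis by (simp add: energy_def)
    qed
    then show ?thesis by blast
  qed
  obtain h where h: "square_integrable (lebesgue_on {0<..<T}) h"
    and h_lim: "(\<lambda>n. \<integral>x. (h x - g n x)\<^sup>2 \<partial>lebesgue_on {0<..<T}) \<longlonglongrightarrow> 0"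
    by (rule L2_complete[OF sg Cauchy])
  have wv: "weak_pair T v h"
    by (rule weak_pair_limit[OF w lim h h_lim T])
  have e_lim: "(\<lambda>n. energy T (g n)) \<longlonglongrightarrow> energy T h"
    unfolding energy_def by (rule L2_tendsto_norm[OF h sg h_lim])
  have hR: "energy T h \<le> R"
    by (rule LIMSEQ_le_const2[OF e_lim]) (use gR in blast)
  have "(\<lambda>n. energy T (g n) / 2 - G (u n)) \<longlonglongrightarrow> energy T h / 2 - G v"
    by (intro tendsto_intros e_lim G_lim) simp
  with \<phi>_lim have "energy T h / 2 - G v = I" by (rule LIMSEQ_unique[symmetric])
  with wv hR I_le show ?thesis by metis
qed

section \<open>Superposition operators\<close>

lemma borel_measurable_lebesgue_on_AE:
  fixes f g :: "real \<Rightarrow> real"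
  assumes S: "S \<in> sets lebesgue" and f: "f \<in> borel_measurable (lebesgue_on S)"
    and ae: "AE x in lebesgue_on S. f x = g x"
  shows "g \<in> borel_measurable (lebesgue_on S)"
proof -
  have "AE x in lebesgue. indicator S x *\<^sub>R f x = indicator S x *\<^sub>R g x"
  proof -
    have "AE x in lebesgue. x \<in> S \<longrightarrow> f x = g x"
      using ae S by (subst (asm) AE_restrict_space_iff) auto
    then show ?thesis by eventually_elim (auto simp: indicator_def)
  qed
  moreover have "(\<lambda>x. indicator S x *\<^sub>R f x) \<in> borel_measurable lebesgue"
    using f S by (simp add: borel_measurable_restrict_space_iff)
  ultimately have "(\<lambda>x. indicator S x *\<^sub>R g x) \<in> borel_measurable lebesgue"
    by (rule borel_measurable_AE[rotated])
  then show ?thesis using S by (simp add: borel_measurable_restrict_space_iff)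
qed

lemma borel_measurable_lebesgue_on_AE_lim:
  fixes f :: "nat \<Rightarrow> real \<Rightarrow> real"
  assumes S: "S \<in> sets lebesgue" and [measurable]: "\<And>n. f n \<in> borel_measurable (lebesgue_on S)"
    and ae: "AE x in lebesgue_on S. (\<lambda>n. f n x) \<longlonglongrightarrow> g x"
  shows "g \<in> borel_measurable (lebesgue_on S)"
proof (rule borel_measurable_lebesgue_on_AE[OF S])
  show "(\<lambda>x. lim (\<lambda>n. f n x)) \<in> borel_measurable (lebesgue_on S)" by measurable
  show "AE x in lebesgue_on S. lim (\<lambda>n. f n x) = g x"
    using ae by eventually_elim (rule limI)
qed

text \<open>Rounding \<open>w\<close> down to multiples of \<open>1/(n+1)\<close> makes it countably valued, so that the composition
  is glued from countably many measurable sections; continuity in the second variable recovers \<open>w\<close>.\<close>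

lemma Caratheodory_composition_measurable:
  fixes F :: "real \<Rightarrow> real \<Rightarrow> real"
  assumes S: "S \<in> sets lebesgue"
    and F: "\<And>x. (\<lambda>\<tau>. F \<tau> x) \<in> borel_measurable (lebesgue_on S)"
    and cont: "AE \<tau> in lebesgue_on S. continuous_on UNIV (F \<tau>)"
    and w: "w \<in> borel_measurable (lebesgue_on S)"
  shows "(\<lambda>\<tau>. F \<tau> (w \<tau>)) \<in> borel_measurable (lebesgue_on S)"
proof (rule borel_measurable_lebesgue_on_AE_lim[OF S])
  let ?a = "\<lambda>n \<tau>. real_of_int \<lfloor>real (Suc n) * w \<tau>\<rfloor> / real (Suc n)"
  show "(\<lambda>\<tau>. F \<tau> (?a n \<tau>)) \<in> borel_measurable (lebesgue_on S)" for n
  proof (rule measurable_compose_countable[of "\<lambda>i \<tau>. F \<tau> (real_of_int i / real (Suc n))"])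
    show "(\<lambda>\<tau>. \<lfloor>real (Suc n) * w \<tau>\<rfloor>) \<in> measurable (lebesgue_on S) (count_space UNIV)"
      using w by measurable
  qed (rule F)
  show "AE \<tau> in lebesgue_on S. (\<lambda>n. F \<tau> (?a n \<tau>)) \<longlonglongrightarrow> F \<tau> (w \<tau>)"
    using cont
  proof eventually_elim
    fix \<tau> assume c: "continuous_on UNIV (F \<tau>)"
    have "(\<lambda>n. ?a n \<tau>) \<longlonglongrightarrow> w \<tau>"
    proof (rule tendsto_sandwich)
      show "(\<lambda>n. w \<tau> + - inverse (real (Suc n))) \<longlonglongrightarrow> w \<tau>"
        by (rule LIMSEQ_inverse_real_of_nat_add_minus)
      show "\<forall>\<^sub>F n in sequentially. w \<tau> + - inverse (real (Suc n)) \<le> ?a n \<tau>"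
      proof (intro always_eventually allI)
        fix n
        have "real (Suc n) * w \<tau> - 1 \<le> real_of_int \<lfloor>real (Suc n) * w \<tau>\<rfloor>" by linarith
        then have "(real (Suc n) * w \<tau> - 1) / real (Suc n) \<le> ?a n \<tau>" by (intro divide_right_mono) auto
        moreover have "(real (Suc n) * w \<tau> - 1) / real (Suc n) = w \<tau> + - inverse (real (Suc n))"
          by (simp add: diff_divide_distrib inverse_eq_divide del: of_nat_Suc)
        ultimately show "w \<tau> + - inverse (real (Suc n)) \<le> ?a n \<tau>" by simp
      qed
      show "\<forall>\<^sub>F n in sequentially. ?a n \<tau> \<le> w \<tau>"
      proof (intro always_eventually allI)
        fix n
        have "real_of_int \<lfloor>real (Suc n) * w \<tau>\<rfloor> \<le> w \<tau> * real (Suc n)" by (simp add: mult.commute)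
        then show "?a n \<tau> \<le> w \<tau>" by (simp add: pos_divide_le_eq del: of_nat_Suc)
      qed
    qed simp
    then show "(\<lambda>n. F \<tau> (?a n \<tau>)) \<longlonglongrightarrow> F \<tau> (w \<tau>)"
      by (rule continuous_on_tendsto_compose[OF c]) auto
  qed
qed

lemma C1_differentiable_on_UNIV_DERIV:
  fixes f :: "real \<Rightarrow> real"
  assumes "f C1_differentiable_on UNIV"
  shows "(f has_real_derivative deriv f x) (at x)"
proof -
  have "f differentiable at x" using assms by (simp add: C1_differentiable_on_eq)
  then obtain D where "(f has_real_derivative D) (at x)" using real_differentiableE by blast
  then show ?thesis using DERIV_imp_deriv by blast
qed

lemma difference_quotient_tendsto:
  fixes f :: "real \<Rightarrow> real"
  assumes f: "(f has_real_derivative D) (at x)" and e: "\<And>n. e n > (0::real)" "e \<longlonglongrightarrow> 0"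
  shows "(\<lambda>n. (f (x + e n * h) - f x) / e n) \<longlonglongrightarrow> D * h"
proof -
  have "((\<lambda>s. x + s * h) has_real_derivative h) (at 0)"
    by (auto intro!: derivative_eq_intros)
  moreover have "(f has_real_derivative D) (at (x + 0 * h))" using f by simp
  ultimately have "((\<lambda>s. f (x + s * h)) has_real_derivative D * h) (at 0)"
    by (rule DERIV_chain2[rotated])
  then have lim: "((\<lambda>s. (f (x + s * h) - f x) / s) \<longlongrightarrow> D * h) (at 0)"
    by (simp add: DERIV_def)
  have "filterlim e (at 0) sequentially"
    using e(2) by (rule filterlim_atI) (use e(1) in \<open>simp add: less_imp_neq[symmetric]\<close>)
  from filterlim_compose[OF lim this] show ?thesis .
qed

text \<open>The bounds concern arguments in \<open>[-1, 1]\<close>, where the increments of the functions in the ball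
  under consideration and of their small perturbations stay.\<close>

locale Caratheodory_C1 =
  fixes S :: "real set" and F :: "real \<Rightarrow> real \<Rightarrow> real" and B :: "real \<Rightarrow> real"
  assumes S: "S \<in> sets lebesgue"
    and F_measurable: "\<And>x. (\<lambda>\<tau>. F \<tau> x) \<in> borel_measurable (lebesgue_on S)"
    and F_C1: "AE \<tau> in lebesgue_on S. F \<tau> C1_differentiable_on UNIV"
    and F_bound: "AE \<tau> in lebesgue_on S. \<forall>x. \<bar>x\<bar> \<le> 1 \<longrightarrow> \<bar>F \<tau> x\<bar> \<le> B \<tau> \<and> \<bar>deriv (F \<tau>) x\<bar> \<le> B \<tau>"
    and B: "integrable (lebesgue_on S) B"
begin

lemma composition_measurable:
  assumes "w \<in> borel_measurable (lebesgue_on S)"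
  shows "(\<lambda>\<tau>. F \<tau> (w \<tau>)) \<in> borel_measurable (lebesgue_on S)"
  by (rule Caratheodory_composition_measurable[OF S F_measurable
      eventually_mono[OF F_C1 C1_differentiable_imp_continuous_on] assms])

lemma composition_integrable:
  assumes w: "w \<in> borel_measurable (lebesgue_on S)" and bd: "\<And>\<tau>. \<tau> \<in> S \<Longrightarrow> \<bar>w \<tau>\<bar> \<le> 1"
  shows "integrable (lebesgue_on S) (\<lambda>\<tau>. F \<tau> (w \<tau>))"
proof (rule Bochner_Integration.integrable_bound[OF B composition_measurable[OF w]])
  show "AE \<tau> in lebesgue_on S. norm (F \<tau> (w \<tau>)) \<le> norm (B \<tau>)"
    using F_bound AE_space by eventually_elim (use bd in fastforce)
qed

lemma composition_integral_continuous:
  assumes wn: "\<And>n. w n \<in> borel_measurable (lebesgue_on S)" and w: "v \<in> borel_measurable (lebesgue_on S)"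
    and bd: "\<And>n \<tau>. \<tau> \<in> S \<Longrightarrow> \<bar>w n \<tau>\<bar> \<le> 1" and lim: "\<And>\<tau>. \<tau> \<in> S \<Longrightarrow> (\<lambda>n. w n \<tau>) \<longlonglongrightarrow> v \<tau>"
  shows "(\<lambda>n. \<integral>\<tau>. F \<tau> (w n \<tau>) \<partial>lebesgue_on S) \<longlonglongrightarrow> (\<integral>\<tau>. F \<tau> (v \<tau>) \<partial>lebesgue_on S)"
proof (rule integral_dominated_convergence[OF composition_measurable[OF w] composition_measurable[OF wn] B])
  show "AE \<tau> in lebesgue_on S. (\<lambda>n. F \<tau> (w n \<tau>)) \<longlonglongrightarrow> F \<tau> (v \<tau>)"
    using F_C1 AE_space
  proof eventually_elim
    fix \<tau> assume "F \<tau> C1_differentiable_on UNIV" "\<tau> \<in> space (lebesgue_on S)"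
    then have "continuous_on UNIV (F \<tau>)" "(\<lambda>n. w n \<tau>) \<longlonglongrightarrow> v \<tau>"
      using lim by (auto simp: C1_differentiable_imp_continuous_on)
    then show "(\<lambda>n. F \<tau> (w n \<tau>)) \<longlonglongrightarrow> F \<tau> (v \<tau>)"
      by (rule continuous_on_tendsto_compose) auto
  qed
  show "AE \<tau> in lebesgue_on S. norm (F \<tau> (w n \<tau>)) \<le> B \<tau>" for n
    using F_bound AE_space by eventually_elim (use bd in auto)
qed

text \<open>The derivative in the second variable is an almost everywhere limit of difference quotients, each
  of which is measurable as a composition.\<close>

lemma deriv_composition_measurable:
  assumes w: "w \<in> borel_measurable (lebesgue_on S)"
  shows "(\<lambda>\<tau>. deriv (F \<tau>) (w \<tau>)) \<in> borel_measurable (lebesgue_on S)"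
proof (rule borel_measurable_lebesgue_on_AE_lim[OF S])
  show "(\<lambda>\<tau>. (F \<tau> (w \<tau> + inverse (real (Suc n)) * 1) - F \<tau> (w \<tau>)) / inverse (real (Suc n)))
      \<in> borel_measurable (lebesgue_on S)" for n
    by (intro borel_measurable_divide borel_measurable_diff composition_measurable borel_measurable_add w borel_measurable_const)
  show "AE \<tau> in lebesgue_on S. (\<lambda>n. (F \<tau> (w \<tau> + inverse (real (Suc n)) * 1) - F \<tau> (w \<tau>)) / inverse (real (Suc n)))
      \<longlonglongrightarrow> deriv (F \<tau>) (w \<tau>)"
    using F_C1
  proof eventually_elim
    fix \<tau> assume "F \<tau> C1_differentiable_on UNIV"
    from difference_quotient_tendsto[OF C1_differentiable_on_UNIV_DERIV[OF this, of "w \<tau>"],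
        of "\<lambda>n. inverse (real (Suc n))" 1]
    show "(\<lambda>n. (F \<tau> (w \<tau> + inverse (real (Suc n)) * 1) - F \<tau> (w \<tau>)) / inverse (real (Suc n)))
      \<longlonglongrightarrow> deriv (F \<tau>) (w \<tau>)"
      using LIMSEQ_inverse_real_of_nat by simp
  qed
qed

text \<open>Differentiation under the integral. The constraint \<open>e n * C \<le> 1/2\<close> keeps the perturbed argument
  in \<open>[-1, 1]\<close>, where the mean value theorem dominates the difference quotients by \<open>C * B\<close>.\<close>

lemma composition_integral_directional_derivative:
  assumes w: "w \<in> borel_measurable (lebesgue_on S)" and bd: "\<And>\<tau>. \<tau> \<in> S \<Longrightarrow> \<bar>w \<tau>\<bar> \<le> 1/2"
    and h: "h \<in> borel_measurable (lebesgue_on S)" and hC: "\<And>\<tau>. \<tau> \<in> S \<Longrightarrow> \<bar>h \<tau>\<bar> \<le> C"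
    and e: "\<And>n. e n > (0::real)" "e \<longlonglongrightarrow> 0" and eC: "\<And>n. e n * C \<le> 1/2"
  shows "(\<lambda>n. ((\<integral>\<tau>. F \<tau> (w \<tau> + e n * h \<tau>) \<partial>lebesgue_on S) - (\<integral>\<tau>. F \<tau> (w \<tau>) \<partial>lebesgue_on S)) / e n)
    \<longlonglongrightarrow> (\<integral>\<tau>. deriv (F \<tau>) (w \<tau>) * h \<tau> \<partial>lebesgue_on S)"
proof -
  have we: "(\<lambda>\<tau>. w \<tau> + e n * h \<tau>) \<in> borel_measurable (lebesgue_on S)" for n
    using w h by measurable
  have eh: "\<bar>e n * h \<tau>\<bar> \<le> 1/2" if "\<tau> \<in> S" for n \<tau>
  proof -
    have "\<bar>e n * h \<tau>\<bar> = e n * \<bar>h \<tau>\<bar>" using e(1)[of n] by (simp add: abs_mult)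
    also have "\<dots> \<le> e n * C" using hC[OF that] e(1)[of n] by (intro mult_left_mono) auto
    finally show ?thesis using eC[of n] by linarith
  qed
  have web: "\<bar>w \<tau> + e n * h \<tau>\<bar> \<le> 1" and wb: "\<bar>w \<tau>\<bar> \<le> 1" if "\<tau> \<in> S" for n \<tau>
    using bd[OF that] eh[OF that, of n] by linarith+
  have "(\<lambda>n. \<integral>\<tau>. (F \<tau> (w \<tau> + e n * h \<tau>) - F \<tau> (w \<tau>)) / e n \<partial>lebesgue_on S)
    \<longlonglongrightarrow> (\<integral>\<tau>. deriv (F \<tau>) (w \<tau>) * h \<tau> \<partial>lebesgue_on S)"
  proof (rule integral_dominated_convergence)
    show "(\<lambda>\<tau>. deriv (F \<tau>) (w \<tau>) * h \<tau>) \<in> borel_measurable (lebesgue_on S)"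
      by (intro borel_measurable_times deriv_composition_measurable w h)
    show "(\<lambda>\<tau>. (F \<tau> (w \<tau> + e n * h \<tau>) - F \<tau> (w \<tau>)) / e n) \<in> borel_measurable (lebesgue_on S)" for n
      by (intro borel_measurable_divide borel_measurable_diff composition_measurable we w borel_measurable_const)
    show "integrable (lebesgue_on S) (\<lambda>\<tau>. C * B \<tau>)" using B by simp
    show "AE \<tau> in lebesgue_on S. (\<lambda>n. (F \<tau> (w \<tau> + e n * h \<tau>) - F \<tau> (w \<tau>)) / e n) \<longlonglongrightarrow> deriv (F \<tau>) (w \<tau>) * h \<tau>"
      using F_C1 by eventually_elim
        (intro difference_quotient_tendsto C1_differentiable_on_UNIV_DERIV e)
    show "AE \<tau> in lebesgue_on S. norm ((F \<tau> (w \<tau> + e n * h \<tau>) - F \<tau> (w \<tau>)) / e n) \<le> C * B \<tau>" for n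
      using F_C1 F_bound AE_space
    proof eventually_elim
      fix \<tau> assume C1: "F \<tau> C1_differentiable_on UNIV"
        and b: "\<forall>x. \<bar>x\<bar> \<le> 1 \<longrightarrow> \<bar>F \<tau> x\<bar> \<le> B \<tau> \<and> \<bar>deriv (F \<tau>) x\<bar> \<le> B \<tau>"
        and "\<tau> \<in> space (lebesgue_on S)"
      then have \<tau>: "\<tau> \<in> S" by simp
      have "norm (F \<tau> (w \<tau> + e n * h \<tau>) - F \<tau> (w \<tau>)) \<le> B \<tau> * norm (w \<tau> + e n * h \<tau> - w \<tau>)"
      proof (rule field_differentiable_bound[of "{-1..1}" "F \<tau>" "deriv (F \<tau>)"])
        show "(F \<tau> has_real_derivative deriv (F \<tau>) z) (at z within {-1..1})" for z
          by (rule has_field_derivative_at_within[OF C1_differentiable_on_UNIV_DERIV[OF C1]])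
      qed (use b web[OF \<tau>, of n] wb[OF \<tau>] in \<open>auto simp: abs_le_iff\<close>)
      also have "\<dots> = e n * (B \<tau> * \<bar>h \<tau>\<bar>)" using e(1)[of n] by (simp add: abs_mult)
      also have "\<dots> \<le> e n * (C * B \<tau>)"
      proof (rule mult_left_mono)
        have "B \<tau> \<ge> 0" using b[rule_format, of 0] by linarith
        then show "B \<tau> * \<bar>h \<tau>\<bar> \<le> C * B \<tau>" using hC[OF \<tau>] by (subst mult.commute) (rule mult_right_mono)
      qed (use e(1)[of n] in simp)
      finally show "norm ((F \<tau> (w \<tau> + e n * h \<tau>) - F \<tau> (w \<tau>)) / e n) \<le> C * B \<tau>"
        using e(1)[of n] by (simp add: pos_divide_le_eq mult.commute)
    qed
  qed
  moreover have "(\<integral>\<tau>. (F \<tau> (w \<tau> + e n * h \<tau>) - F \<tau> (w \<tau>)) / e n \<partial>lebesgue_on S)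
    = ((\<integral>\<tau>. F \<tau> (w \<tau> + e n * h \<tau>) \<partial>lebesgue_on S) - (\<integral>\<tau>. F \<tau> (w \<tau>) \<partial>lebesgue_on S)) / e n" for n
    using composition_integrable[OF we web, of n] composition_integrable[OF w wb] by simp
  ultimately show ?thesis by (simp only:)
qed

end

section \<open>Critical points on a split interval\<close>

text \<open>At an interior minimiser every direction is admissible for small steps. Expanding the energy to
  second order, dividing by the step and letting it tend to \<open>0\<close> from above gives one inequality; the
  opposite one comes from reversing the direction.\<close>

lemma ball_minimizer_variational_inequality:
  assumes u: "weak_pair T u g" and inner: "energy T g < R"
    and min: "\<And>v h. weak_pair T v h \<Longrightarrow> energy T h \<le> R \<Longrightarrow> energy T g / 2 - G u \<le> energy T h / 2 - G v"
    and v: "weak_pair T v h"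
    and e: "\<And>n. e n > (0::real)" "e \<longlonglongrightarrow> 0"
    and L: "(\<lambda>n. (G (\<lambda>x. u x + e n * v x) - G u) / e n) \<longlonglongrightarrow> L"
  shows "L \<le> (\<integral>x. g x * h x \<partial>lebesgue_on {0<..<T})"
proof -
  let ?c = "\<integral>x. g x * h x \<partial>lebesgue_on {0<..<T}"
  have sg: "square_integrable (lebesgue_on {0<..<T}) g" and sh: "square_integrable (lebesgue_on {0<..<T}) h"
    using u v by (auto simp: weak_pair_def)
  have en: "energy T (\<lambda>x. g x + e n * h x) = energy T g + e n * (2 * ?c + e n * energy T h)" for n
    using integral_lincomb_square[OF sg sh, of 1 "e n"]
    by (simp add: energy_def power2_eq_square algebra_simps)
  have w: "weak_pair T (\<lambda>x. u x + e n * v x) (\<lambda>x. g x + e n * h x)" for n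
    using weak_pair_lincomb[OF u v, of 1 "e n"] by simp
  have "(\<lambda>n. energy T (\<lambda>x. g x + e n * h x)) \<longlonglongrightarrow> energy T g + 0 * (2 * ?c + 0 * energy T h)"
    unfolding en by (intro tendsto_intros e)
  then have "\<forall>\<^sub>F n in sequentially. energy T (\<lambda>x. g x + e n * h x) < R"
    using inner by (intro order_tendstoD) auto
  then have ev: "\<forall>\<^sub>F n in sequentially. (G (\<lambda>x. u x + e n * v x) - G u) / e n \<le> ?c + e n * energy T h / 2"
  proof eventually_elim
    case (elim n)
    have "energy T g / 2 - G u \<le> energy T (\<lambda>x. g x + e n * h x) / 2 - G (\<lambda>x. u x + e n * v x)"
      by (rule min[OF w]) (use elim in simp)
    then have "G (\<lambda>x. u x + e n * v x) - G u \<le> (?c + e n * energy T h / 2) * e n"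
      unfolding en by (simp add: algebra_simps)
    then show ?case using e(1)[of n] by (simp add: pos_divide_le_eq)
  qed
  have "(\<lambda>n. ?c + e n * energy T h / 2) \<longlonglongrightarrow> ?c + 0 * energy T h / 2"
    by (intro tendsto_intros e) simp
  from tendsto_le[OF _ this L ev] show ?thesis by simp
qed

locale split_interval_problem =
  fixes N :: nat and T :: real and s t \<alpha> :: "nat \<Rightarrow> real"
    and \<Phi> :: "nat \<Rightarrow> real \<Rightarrow> real \<Rightarrow> real" and B :: "nat \<Rightarrow> real \<Rightarrow> real"
  assumes T_pos: "T > 0"
    and pieces: "\<And>i. i \<le> N \<Longrightarrow> 0 \<le> s i \<and> s i < t (Suc i) \<and> t (Suc i) \<le> T"
    and \<Phi>: "\<And>i. i \<le> N \<Longrightarrow> Caratheodory_C1 {s i<..t (Suc i)} (\<Phi> i) (B i)"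
begin

text \<open>The part of the variational functional of lower order, and its formal derivative at \<open>u\<close> in the
  direction \<open>v\<close>: weak solutions are the critical points of \<open>energy / 2 - load\<close>.\<close>

definition load :: "(real \<Rightarrow> real) \<Rightarrow> real" where
  "load u = (\<Sum>i=1..N. (\<alpha> (i - 1) - \<alpha> i) * u (t i))
     + (\<Sum>i=0..N. \<integral>\<tau>. \<Phi> i \<tau> (u \<tau> - u (t (Suc i))) \<partial>lebesgue_on {s i<..t (Suc i)})"

definition load_deriv :: "(real \<Rightarrow> real) \<Rightarrow> (real \<Rightarrow> real) \<Rightarrow> real" where
  "load_deriv u v = (\<Sum>i=1..N. (\<alpha> (i - 1) - \<alpha> i) * v (t i))
     + (\<Sum>i=0..N. \<integral>\<tau>. deriv (\<Phi> i \<tau>) (u \<tau> - u (t (Suc i))) * (v \<tau> - v (t (Suc i)))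
          \<partial>lebesgue_on {s i<..t (Suc i)})"

lemma piece_subset: "i \<le> N \<Longrightarrow> {s i<..t (Suc i)} \<subseteq> {0..T}" "i \<le> N \<Longrightarrow> t (Suc i) \<in> {0..T}"
  using pieces[of i] by auto

lemma t_in: "i \<in> {1..N} \<Longrightarrow> t i \<in> {0..T}"
  using piece_subset(2)[of "i - 1"] by auto

lemma increment_measurable:
  fixes u :: "real \<Rightarrow> real"
  assumes "continuous_on {0..T} u" "i \<le> N"
  shows "(\<lambda>\<tau>. u \<tau> - u (t (Suc i))) \<in> borel_measurable (lebesgue_on {s i<..t (Suc i)})"
  using continuous_on_subset[OF assms(1) piece_subset(1)[OF assms(2)]]
  by (intro continuous_imp_measurable_on_sets_lebesgue continuous_on_diff continuous_on_const) auto

lemma increment_bound: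
  assumes u: "weak_pair T u g" and R: "energy T g \<le> R" and small: "sqrt R * sqrt T \<le> 1/2"
    and xy: "x \<in> {0..T}" "y \<in> {0..T}"
  shows "\<bar>u x - u y\<bar> \<le> 1/2"
proof -
  have "R \<ge> 0" using R energy_nonneg[of T g] by linarith
  have "\<bar>u x - u y\<bar> \<le> sqrt (energy T g) * sqrt \<bar>x - y\<bar>" by (rule weak_pair_Hoelder[OF u T_pos xy])
  also have "\<dots> \<le> sqrt R * sqrt T"
    using xy R \<open>R \<ge> 0\<close> by (intro mult_mono real_sqrt_le_mono) auto
  finally show ?thesis using small by linarith
qed

lemma load_continuous:
  assumes small: "sqrt R * sqrt T \<le> 1/2"
    and w: "\<And>n. weak_pair T (u n) (g n)" and R: "\<And>n. energy T (g n) \<le> R"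
    and v: "continuous_on {0..T} v" and lim: "uniform_limit {0..T} u v sequentially"
  shows "(\<lambda>n. load (u n)) \<longlonglongrightarrow> load v"
proof -
  have pt: "(\<lambda>n. u n x) \<longlonglongrightarrow> v x" if "x \<in> {0..T}" for x
    using lim that by (rule tendsto_uniform_limitI)
  have "(\<lambda>n. \<integral>\<tau>. \<Phi> i \<tau> (u n \<tau> - u n (t (Suc i))) \<partial>lebesgue_on {s i<..t (Suc i)})
      \<longlonglongrightarrow> (\<integral>\<tau>. \<Phi> i \<tau> (v \<tau> - v (t (Suc i))) \<partial>lebesgue_on {s i<..t (Suc i)})" if i: "i \<in> {0..N}" for i
  proof (rule Caratheodory_C1.composition_integral_continuous[OF \<Phi>])
    show "i \<le> N" using i by simp
    note sub = piece_subset[OF this]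
    show "(\<lambda>\<tau>. u n \<tau> - u n (t (Suc i))) \<in> borel_measurable (lebesgue_on {s i<..t (Suc i)})" for n
      using i w[of n] by (intro increment_measurable) (auto simp: weak_pair_def)
    show "(\<lambda>\<tau>. v \<tau> - v (t (Suc i))) \<in> borel_measurable (lebesgue_on {s i<..t (Suc i)})"
      using i v by (intro increment_measurable) auto
    fix \<tau> assume "\<tau> \<in> {s i<..t (Suc i)}"
    then have \<tau>: "\<tau> \<in> {0..T}" using sub by blast
    show "(\<lambda>n. u n \<tau> - u n (t (Suc i))) \<longlonglongrightarrow> v \<tau> - v (t (Suc i))"
      by (intro tendsto_intros pt \<tau> sub)
    show "\<bar>u n \<tau> - u n (t (Suc i))\<bar> \<le> 1" for n
      using increment_bound[OF w R small \<tau> sub(2), of n] by linarith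
  qed
  then show ?thesis unfolding load_def by (intro tendsto_intros pt t_in)
qed

lemma load_directional_derivative:
  assumes small: "sqrt R * sqrt T \<le> 1/2" and u: "weak_pair T u g" and R: "energy T g \<le> R"
    and v: "weak_pair T v h"
  obtains e where "\<And>n. e n > (0::real)" "e \<longlonglongrightarrow> 0"
    "(\<lambda>n. (load (\<lambda>x. u x + e n * v x) - load u) / e n) \<longlonglongrightarrow> load_deriv u v"
proof -
  have cu: "continuous_on {0..T} u" and cv: "continuous_on {0..T} v"
    using u v by (auto simp: weak_pair_def)
  define C where "C = sqrt (energy T h) * sqrt T"
  have C0: "C \<ge> 0" using T_pos by (simp add: C_def energy_nonneg)
  have C: "\<bar>v x - v y\<bar> \<le> C" if "x \<in> {0..T}" "y \<in> {0..T}" for x y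
  proof -
    have "\<bar>v x - v y\<bar> \<le> sqrt (energy T h) * sqrt \<bar>x - y\<bar>" by (rule weak_pair_Hoelder[OF v T_pos that])
    also have "\<dots> \<le> C" unfolding C_def using that
      by (intro mult_left_mono real_sqrt_le_mono) (auto simp: energy_nonneg)
    finally show ?thesis .
  qed
  \<comment> \<open>The factor \<open>1 / (2 * C + 1)\<close> gives \<open>e n * C \<le> 1/2\<close>, also when \<open>C = 0\<close>.\<close>
  define e where "e n = inverse (real (Suc n)) * inverse (2 * C + 1)" for n
  have e: "e n > 0" for n using C0 by (simp add: e_def)
  have "e \<longlonglongrightarrow> 0 * inverse (2 * C + 1)"
    unfolding e_def[abs_def] by (intro tendsto_intros LIMSEQ_inverse_real_of_nat)
  then have e0: "e \<longlonglongrightarrow> 0" by simp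
  have eC: "e n * C \<le> 1/2" for n
  proof -
    have "inverse (real (Suc n)) \<le> 1" by (simp add: field_simps)
    then have "e n \<le> 1 * inverse (2 * C + 1)" unfolding e_def using C0 by (intro mult_right_mono) auto
    then have "e n * C \<le> (1 * inverse (2 * C + 1)) * C" using C0 by (rule mult_right_mono)
    also have "\<dots> \<le> 1/2" using C0 by (simp add: field_simps)
    finally show ?thesis .
  qed
  let ?I = "\<lambda>u i. \<integral>\<tau>. \<Phi> i \<tau> (u \<tau> - u (t (Suc i))) \<partial>lebesgue_on {s i<..t (Suc i)}"
  have piece: "(\<lambda>n. (?I (\<lambda>x. u x + e n * v x) i - ?I u i) / e n)
     \<longlonglongrightarrow> (\<integral>\<tau>. deriv (\<Phi> i \<tau>) (u \<tau> - u (t (Suc i))) * (v \<tau> - v (t (Suc i))) \<partial>lebesgue_on {s i<..t (Suc i)})"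
    if i: "i \<in> {0..N}" for i
  proof -
    have iN: "i \<le> N" using i by simp
    note sub = piece_subset[OF iN]
    have "(\<lambda>n. ((\<integral>\<tau>. \<Phi> i \<tau> ((u \<tau> - u (t (Suc i))) + e n * (v \<tau> - v (t (Suc i)))) \<partial>lebesgue_on {s i<..t (Suc i)}) - ?I u i) / e n)
     \<longlonglongrightarrow> (\<integral>\<tau>. deriv (\<Phi> i \<tau>) (u \<tau> - u (t (Suc i))) * (v \<tau> - v (t (Suc i))) \<partial>lebesgue_on {s i<..t (Suc i)})"
    proof (rule Caratheodory_C1.composition_integral_directional_derivative[OF \<Phi>[OF iN] _ _ _ _ e e0 eC])
      show "(\<lambda>\<tau>. u \<tau> - u (t (Suc i))) \<in> borel_measurable (lebesgue_on {s i<..t (Suc i)})"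
        "(\<lambda>\<tau>. v \<tau> - v (t (Suc i))) \<in> borel_measurable (lebesgue_on {s i<..t (Suc i)})"
        by (intro increment_measurable iN cu cv)+
      fix \<tau> assume "\<tau> \<in> {s i<..t (Suc i)}"
      then have \<tau>: "\<tau> \<in> {0..T}" using sub by blast
      show "\<bar>u \<tau> - u (t (Suc i))\<bar> \<le> 1/2" by (rule increment_bound[OF u R small \<tau> sub(2)])
      show "\<bar>v \<tau> - v (t (Suc i))\<bar> \<le> C" by (rule C[OF \<tau> sub(2)])
    qed
    then show ?thesis by (simp add: algebra_simps)
  qed
  have "(load (\<lambda>x. u x + e n * v x) - load u) / e n
      = (\<Sum>i=1..N. (\<alpha> (i - 1) - \<alpha> i) * v (t i)) + (\<Sum>i=0..N. (?I (\<lambda>x. u x + e n * v x) i - ?I u i) / e n)" for n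
  proof -
    have "(\<Sum>i=1..N. (\<alpha> (i - 1) - \<alpha> i) * (u (t i) + e n * v (t i)))
      = (\<Sum>i=1..N. (\<alpha> (i - 1) - \<alpha> i) * u (t i)) + e n * (\<Sum>i=1..N. (\<alpha> (i - 1) - \<alpha> i) * v (t i))"
      by (simp add: sum_distrib_left sum.distrib[symmetric] algebra_simps)
    then have "load (\<lambda>x. u x + e n * v x) - load u = e n * (\<Sum>i=1..N. (\<alpha> (i - 1) - \<alpha> i) * v (t i))
      + (\<Sum>i=0..N. ?I (\<lambda>x. u x + e n * v x) i - ?I u i)"
      unfolding load_def sum_subtractf by linarith
    then show ?thesis using e[of n] by (simp add: add_divide_distrib sum_divide_distrib)
  qed
  then have "(\<lambda>n. (load (\<lambda>x. u x + e n * v x) - load u) / e n) \<longlonglongrightarrow> load_deriv u v"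
    unfolding load_deriv_def by (simp only:) (intro tendsto_add tendsto_const tendsto_sum piece)
  with e e0 show ?thesis by (rule that)
qed

text \<open>On the sphere \<open>energy = R\<close> the functional is at least \<open>R / 2 - K > 0\<close>, whereas it vanishes at the
  zero function. A minimiser over the ball is therefore interior, and it satisfies the Euler--Lagrange
  equation.\<close>

theorem critical_point_in_ball:
  assumes R: "R \<ge> 0" and small: "sqrt R * sqrt T \<le> 1/2"
    and bound: "\<And>u g. weak_pair T u g \<Longrightarrow> energy T g \<le> R \<Longrightarrow> load u \<le> K"
    and gap: "K < R / 2" and zero: "load (\<lambda>_. 0) = 0"
  shows "\<exists>u g. weak_pair T u g \<and>
    (\<forall>v h. weak_pair T v h \<longrightarrow> (\<integral>x. g x * h x \<partial>lebesgue_on {0<..<T}) = load_deriv u v)"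
proof -
  have "\<exists>u g. weak_pair T u g \<and> energy T g \<le> R \<and>
    (\<forall>v h. weak_pair T v h \<longrightarrow> energy T h \<le> R \<longrightarrow> energy T g / 2 - load u \<le> energy T h / 2 - load v)"
  proof (rule weak_pair_ball_minimizer[OF T_pos R])
    show "load u \<le> K" if "weak_pair T u g" "energy T g \<le> R" for u g
      using that by (rule bound)
    show "(\<lambda>n. load (u n)) \<longlonglongrightarrow> load v"
      if "\<And>n. weak_pair T (u n) (g n)" "\<And>n. energy T (g n) \<le> R"
        "continuous_on {0..T} v" "uniform_limit {0..T} u v sequentially" for u g v
      using that by (rule load_continuous[OF small])
  qed
  then obtain u g where u: "weak_pair T u g" and uR: "energy T g \<le> R"
    and min: "\<And>v h. weak_pair T v h \<Longrightarrow> energy T h \<le> R \<Longrightarrow> energy T g / 2 - load u \<le> energy T h / 2 - load v"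
    by blast
  have "energy T g / 2 - load u \<le> 0"
    using min[OF weak_pair_zero] R zero by (simp add: energy_def)
  then have inner: "energy T g < R"
    using bound[OF u uR] gap by linarith
  have le: "load_deriv u v \<le> (\<integral>x. g x * h x \<partial>lebesgue_on {0<..<T})" if v: "weak_pair T v h" for v h
  proof (rule load_directional_derivative[OF small u uR v])
    fix e :: "nat \<Rightarrow> real"
    assume e: "\<And>n. e n > 0" "e \<longlonglongrightarrow> 0"
      and L: "(\<lambda>n. (load (\<lambda>x. u x + e n * v x) - load u) / e n) \<longlonglongrightarrow> load_deriv u v"
    show ?thesis
      by (rule ball_minimizer_variational_inequality[where G = load and e = e, OF u inner min v e L])
  qed
  have "(\<integral>x. g x * h x \<partial>lebesgue_on {0<..<T}) = load_deriv u v" if v: "weak_pair T v h" for v h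
  proof (rule antisym)
    have "weak_pair T (\<lambda>x. - v x) (\<lambda>x. - h x)"
      using weak_pair_lincomb[OF v weak_pair_zero, of "-1" 0] by simp
    from le[OF this] have "load_deriv u (\<lambda>x. - v x) \<le> - (\<integral>x. g x * h x \<partial>lebesgue_on {0<..<T})" by simp
    moreover have "load_deriv u (\<lambda>x. - v x) = - load_deriv u v"
    proof -
      have *: "a * (- b - - c) = - (a * (b - c))" for a b c :: real by (simp add: algebra_simps)
      show ?thesis unfolding load_deriv_def * by (simp add: sum_negf)
    qed
    ultimately show "(\<integral>x. g x * h x \<partial>lebesgue_on {0<..<T}) \<le> load_deriv u v" by linarith
  qed (rule le[OF v])
  with u show ?thesis by blast
qed

end

section \<open>Existence of a weak solution\<close>

text \<open>This absorbs the forcing term \<open>p\<close> into the nonlinearity.\<close>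

lemma (in Caratheodory_C1) add_linear:
  assumes p: "integrable (lebesgue_on S) p"
  shows "Caratheodory_C1 S (\<lambda>\<tau> x. F \<tau> x + p \<tau> * x) (\<lambda>\<tau>. B \<tau> + \<bar>p \<tau>\<bar>)"
    and "AE \<tau> in lebesgue_on S. \<forall>x. deriv (\<lambda>x. F \<tau> x + p \<tau> * x) x = deriv (F \<tau>) x + p \<tau>"
proof -
  have d: "((\<lambda>x. F \<tau> x + p \<tau> * x) has_real_derivative deriv (F \<tau>) x + p \<tau>) (at x)"
    if "F \<tau> C1_differentiable_on UNIV" for \<tau> x
    using C1_differentiable_on_UNIV_DERIV[OF that, of x]
    by (auto intro!: derivative_eq_intros)
  then have deriv: "deriv (\<lambda>x. F \<tau> x + p \<tau> * x) x = deriv (F \<tau>) x + p \<tau>"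
    if "F \<tau> C1_differentiable_on UNIV" for \<tau> x
    using that DERIV_imp_deriv by blast
  show "AE \<tau> in lebesgue_on S. \<forall>x. deriv (\<lambda>x. F \<tau> x + p \<tau> * x) x = deriv (F \<tau>) x + p \<tau>"
    using F_C1 by eventually_elim (use deriv in blast)
  show "Caratheodory_C1 S (\<lambda>\<tau> x. F \<tau> x + p \<tau> * x) (\<lambda>\<tau>. B \<tau> + \<bar>p \<tau>\<bar>)"
  proof
    show "S \<in> sets lebesgue" by (rule S)
    have "p \<in> borel_measurable (lebesgue_on S)" using p by auto
    then show "(\<lambda>\<tau>. F \<tau> x + p \<tau> * x) \<in> borel_measurable (lebesgue_on S)" for x
      using F_measurable[of x] by measurable
    show "AE \<tau> in lebesgue_on S. (\<lambda>x. F \<tau> x + p \<tau> * x) C1_differentiable_on UNIV"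
      using F_C1 by eventually_elim
        (intro C1_differentiable_on_add C1_differentiable_on_mult C1_differentiable_on_const
          C1_differentiable_on_ident)
    show "integrable (lebesgue_on S) (\<lambda>\<tau>. B \<tau> + \<bar>p \<tau>\<bar>)" using B p by simp
    show "AE \<tau> in lebesgue_on S. \<forall>x. \<bar>x\<bar> \<le> 1 \<longrightarrow> \<bar>F \<tau> x + p \<tau> * x\<bar> \<le> B \<tau> + \<bar>p \<tau>\<bar> \<and>
        \<bar>deriv (\<lambda>x. F \<tau> x + p \<tau> * x) x\<bar> \<le> B \<tau> + \<bar>p \<tau>\<bar>"
      using F_C1 F_bound
    proof eventually_elim
      case (elim \<tau>)
      show ?case
      proof (intro allI impI conjI)
        fix x :: real assume x: "\<bar>x\<bar> \<le> 1"
        have b: "\<bar>F \<tau> x\<bar> \<le> B \<tau>" "\<bar>deriv (F \<tau>) x\<bar> \<le> B \<tau>" using elim(2) x by auto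
        have "\<bar>p \<tau> * x\<bar> \<le> \<bar>p \<tau>\<bar>" using x by (simp add: abs_mult mult_left_le)
        then show "\<bar>F \<tau> x + p \<tau> * x\<bar> \<le> B \<tau> + \<bar>p \<tau>\<bar>" using b(1) by linarith
        show "\<bar>deriv (\<lambda>x. F \<tau> x + p \<tau> * x) x\<bar> \<le> B \<tau> + \<bar>p \<tau>\<bar>"
          unfolding deriv[OF elim(1)] using b(2) by linarith
      qed
    qed
  qed
qed

lemma Max_image_abs_eq_1: "Max (f ` {x::real. \<bar>x\<bar> = 1}) = max (f 1) (f (- 1))"
proof -
  have "{x::real. \<bar>x\<bar> = 1} = {1, -1}" by auto
  then show ?thesis by simp
qed

text \<open>The superlinearity condition forces the derivative to have the sign of its argument, so the
  function increases with the distance from \<open>0\<close> on either side.\<close>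

lemma superlinear_le_Max_unit_sphere:
  fixes f :: "real \<Rightarrow> real"
  assumes f: "f C1_differentiable_on UNIV" and f0: "f 0 = 0" and mu: "\<mu> > 0"
    and AR: "\<And>x. x \<noteq> 0 \<Longrightarrow> 0 < \<mu> * f x \<and> \<mu> * f x \<le> x * deriv f x"
    and x: "\<bar>x\<bar> \<le> 1"
  shows "f x \<le> Max (f ` {x. \<bar>x\<bar> = 1})"
proof -
  note D = C1_differentiable_on_UNIV_DERIV[OF f]
  have sgn: "0 < z * deriv f z" if "z \<noteq> 0" for z using AR[OF that] by linarith
  have pos: "0 < deriv f z" if "z > 0" for z
    using sgn[of z] that by (simp add: zero_less_mult_iff)
  have neg: "deriv f z < 0" if "z < 0" for z
    using sgn[of z] that by (simp add: zero_less_mult_iff)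
  consider "x = 0" | "x > 0" | "x < 0" by linarith
  then have "f x \<le> f 1 \<or> f x \<le> f (- 1)"
  proof cases
    case 1
    then show ?thesis using AR[of 1] mu f0 by (simp add: zero_less_mult_iff)
  next
    case 2
    have "f x \<le> f 1"
    proof (rule DERIV_nonneg_imp_nondecreasing[of x 1 f])
      show "\<exists>y. DERIV f z :> y \<and> 0 \<le> y" if "x \<le> z" "z \<le> 1" for z
        using D[of z] pos[of z] that 2 by (intro exI[of _ "deriv f z"]) auto
    qed (use x in auto)
    then show ?thesis ..
  next
    case 3
    have "f (- 1) \<ge> f x"
    proof (rule DERIV_nonpos_imp_nonincreasing[of "- 1" x f])
      show "\<exists>y. DERIV f z :> y \<and> y \<le> 0" if "-1 \<le> z" "z \<le> x" for z
        using D[of z] neg[of z] that 3 by (intro exI[of _ "deriv f z"]) auto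
    qed (use x in auto)
    then show ?thesis ..
  qed
  then show ?thesis unfolding Max_image_abs_eq_1 by auto
qed

lemma AE_lebesgue_on_Ioc:
  assumes "AE \<tau>\<in>{a<..<b} in lebesgue. Q \<tau>"
  shows "AE \<tau> in lebesgue_on {a<..b::real}. Q \<tau>"
proof -
  have "AE \<tau> in lebesgue. \<tau> \<noteq> b"
    by (intro AE_completion AE_lborel_singleton)
  then have "AE \<tau> in lebesgue. \<tau> \<in> {a<..b} \<longrightarrow> Q \<tau>"
    using assms by eventually_elim auto
  then show ?thesis by (subst AE_restrict_space_iff) auto
qed

lemma integrable_lebesgue_on_indicator_mult:
  fixes f :: "real \<Rightarrow> real"
  assumes "set_integrable lebesgue A f" "S \<in> sets lebesgue"
  shows "integrable (lebesgue_on S) (\<lambda>x. indicator A x * f x)"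
  by (rule integrable_lebesgue_on_subset[of UNIV])
    (use assms in \<open>auto simp: lebesgue_on_UNIV_eq set_integrable_def\<close>)

lemma L2_norm_piece_le:
  assumes J: "finite J" "i \<in> J" and A: "\<And>j. j \<in> J \<Longrightarrow> A j \<in> sets lebesgue" "\<And>j. j \<in> J \<Longrightarrow> A j \<subseteq> {0..T}"
    and p: "\<And>j. j \<in> J \<Longrightarrow> square_integrable (lebesgue_on (A j)) p"
  shows "sqrt (\<integral>x. (p x)\<^sup>2 \<partial>lebesgue_on (A i)) \<le> L2_norm T (\<lambda>\<tau>. if \<tau> \<in> (\<Union>j\<in>J. A j) then p \<tau> else 0)"
proof -
  let ?U = "\<Union>j\<in>J. A j"
  have U: "?U \<in> sets lebesgue" using J A by blast
  have "set_integrable lebesgue (A j) (\<lambda>x. (p x)\<^sup>2)" if "j \<in> J" for j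
    using p[OF that] A(1)[OF that]
    by (simp add: square_integrable_def set_integrable_def integrable_restrict_space)
  then have "set_integrable lebesgue ?U (\<lambda>x. (p x)\<^sup>2)"
    by (intro set_integrable_UN J A)
  then have int: "integrable (lebesgue_on ?U) (\<lambda>x. (p x)\<^sup>2)"
    using U by (simp add: set_integrable_def integrable_restrict_space)
  have "(\<integral>x. (p x)\<^sup>2 \<partial>lebesgue_on (A i)) = (\<integral>x. indicator (A i) x * (p x)\<^sup>2 \<partial>lebesgue)"
    using A(1)[OF J(2)] by (simp add: integral_restrict_space)
  also have "\<dots> \<le> (\<integral>x. indicator ?U x * (p x)\<^sup>2 \<partial>lebesgue)"
  proof (rule integral_mono)
    show "integrable lebesgue (\<lambda>x. indicator (A i) x * (p x)\<^sup>2)"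
      using p[OF J(2)] A(1)[OF J(2)] by (simp add: square_integrable_def integrable_restrict_space)
    show "integrable lebesgue (\<lambda>x. indicator ?U x * (p x)\<^sup>2)"
      using int U by (simp add: integrable_restrict_space)
    show "indicator (A i) x * (p x)\<^sup>2 \<le> indicator ?U x * (p x)\<^sup>2" for x
      using J(2) by (intro mult_right_mono) (auto simp: indicator_def)
  qed
  also have "\<dots> = (LINT \<tau>:{0..T}|lebesgue. \<bar>if \<tau> \<in> ?U then p \<tau> else 0\<bar>\<^sup>2)"
    unfolding set_lebesgue_integral_def
    by (intro Bochner_Integration.integral_cong refl) (use subsetD[OF A(2)] in \<open>auto simp: indicator_def\<close>)
  finally show ?thesis unfolding L2_norm_def by (rule real_sqrt_le_mono)
qed

lemma integral_Ioc_mult_le: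
  fixes p w :: "real \<Rightarrow> real"
  assumes p: "square_integrable (lebesgue_on {a<..b}) p" and w: "w \<in> borel_measurable (lebesgue_on {a<..b})"
    and w1: "\<And>x. x \<in> {a<..b} \<Longrightarrow> \<bar>w x\<bar> \<le> 1" and ab: "a \<le> b"
  shows "integrable (lebesgue_on {a<..b}) (\<lambda>x. p x * w x)"
    "(\<integral>x. p x * w x \<partial>lebesgue_on {a<..b}) \<le> sqrt (b - a) * sqrt (\<integral>x. (p x)\<^sup>2 \<partial>lebesgue_on {a<..b})"
proof -
  have one: "integrable (lebesgue_on {a<..b}) (\<lambda>x. 1::real)"
    by (rule integrable_lebesgue_on_subset[OF continuous_imp_integrable_real[of a b]]) auto
  have sq: "(w x)\<^sup>2 \<le> 1" if "x \<in> {a<..b}" for x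
    using w1[OF that] by (simp add: abs_square_le_1)
  have sw: "square_integrable (lebesgue_on {a<..b}) w"
    unfolding square_integrable_def
  proof (intro conjI w Bochner_Integration.integrable_bound[OF one])
    show "(\<lambda>x. (w x)\<^sup>2) \<in> borel_measurable (lebesgue_on {a<..b})" using w by measurable
    show "AE x in lebesgue_on {a<..b}. norm ((w x)\<^sup>2) \<le> norm (1::real)"
      by (rule AE_I2) (use sq in auto)
  qed
  show "integrable (lebesgue_on {a<..b}) (\<lambda>x. p x * w x)"
    by (rule square_integrable_mult_integrable[OF p sw])
  have "(\<integral>x. (w x)\<^sup>2 \<partial>lebesgue_on {a<..b}) \<le> (\<integral>x. 1 \<partial>lebesgue_on {a<..b})"
    by (rule integral_mono) (use sw one sq in \<open>auto simp: square_integrable_def\<close>)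
  also have "\<dots> = b - a" using ab by (simp add: measure_restrict_space)
  finally have wn: "(\<integral>x. (w x)\<^sup>2 \<partial>lebesgue_on {a<..b}) \<le> b - a" .
  have "(\<integral>x. p x * w x \<partial>lebesgue_on {a<..b})
    \<le> sqrt (\<integral>x. (p x)\<^sup>2 \<partial>lebesgue_on {a<..b}) * sqrt (\<integral>x. (w x)\<^sup>2 \<partial>lebesgue_on {a<..b})"
    using integral_Cauchy_Schwarz[OF p sw] by linarith
  also have "\<dots> \<le> sqrt (\<integral>x. (p x)\<^sup>2 \<partial>lebesgue_on {a<..b}) * sqrt (b - a)"
    by (intro mult_left_mono real_sqrt_le_mono wn) simp
  finally show "(\<integral>x. p x * w x \<partial>lebesgue_on {a<..b}) \<le> sqrt (b - a) * sqrt (\<integral>x. (p x)\<^sup>2 \<partial>lebesgue_on {a<..b})"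
    by (simp add: mult.commute)
qed

theorem theorem1p2:
  fixes N :: nat and T :: real and s t \<alpha> :: "nat \<Rightarrow> real"
    and p :: "real \<Rightarrow> real" and F :: "nat \<Rightarrow> real \<Rightarrow> real \<Rightarrow> real" and \<beta> M :: real
  assumes N: "N \<ge> 1"
    and s_0: "s 0 = 0"
    and s_less_t: "\<And>i. i \<le> N \<Longrightarrow> s i < t (Suc i)"
    and t_less_s: "\<And>i. 1 \<le> i \<Longrightarrow> i \<le> N \<Longrightarrow> t i < s i"
    and t_last: "t (Suc N) = T"
    and p_L2: "\<And>i. i \<le> N \<Longrightarrow> L2_on {s i<..t (Suc i)} p"
    and F_meas: "\<And>i x. i \<le> N \<Longrightarrow> set_borel_measurable lebesgue {s i<..t (Suc i)} (\<lambda>\<tau>. F i \<tau> x)"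
    and F_C1: "\<And>i. i \<le> N \<Longrightarrow>
          AE \<tau>\<in>{s i<..t (Suc i)} in lebesgue. F i \<tau> C1_differentiable_on UNIV"
    and H1: "\<exists>a b. continuous_on {0..} a \<and> (\<forall>x\<ge>0. a x \<ge> 0) \<and>
          (\<forall>i\<le>N. set_integrable lebesgue {s i<..<t (Suc i)} b \<and>
             (\<forall>\<tau>\<in>{s i<..<t (Suc i)}. b \<tau> \<ge> 0) \<and>
             (AE \<tau>\<in>{s i<..<t (Suc i)} in lebesgue.
                (\<forall>x. \<bar>F i \<tau> x\<bar> \<le> a \<bar>x\<bar> * b \<tau> \<and> \<bar>deriv (F i \<tau>) x\<bar> \<le> a \<bar>x\<bar> * b \<tau>) \<and>
                F i \<tau> 0 = 0))"
    and H2: "\<exists>\<mu>. \<forall>i\<le>N. \<mu> i > (2::real) \<and>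
          (AE \<tau>\<in>{s i<..t (Suc i)} in lebesgue. \<forall>x. x \<noteq> 0 \<longrightarrow>
             0 < \<mu> i * F i \<tau> x \<and> \<mu> i * F i \<tau> x \<le> x * deriv (F i \<tau>) x)"
    and beta: "\<beta> = (T * first_eigenvalue T) powr (- 1 / 2) + T powr (1 / 2)"
    and M: "M = 1 / (8 * \<beta>\<^sup>2) - 1 / 2 * (\<Sum>i=1..N. \<bar>\<alpha> (i - 1) - \<alpha> i\<bar>)
          - (\<Sum>i=0..N. LINT \<tau>:{s i<..t (Suc i)}|lebesgue. Max (F i \<tau> ` {x. \<bar>x\<bar> = 1}))"
    and H3: "(\<Sum>i=0..N. sqrt (t (Suc i) - s i) *
            L2_norm T (\<lambda>\<tau>. if \<tau> \<in> (\<Union>i\<in>{0..N}. {s i<..t (Suc i)}) then p \<tau> else 0)) < M"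
  shows "\<exists>u. weak_solution N s t \<alpha> F p u"
proof -
  let ?P = "\<lambda>i. {s i<..t (Suc i)}"
  let ?len = "\<lambda>i. t (Suc i) - s i"
  have s_nonneg: "0 \<le> s i" if "i \<le> N" for i
    using that
  proof (induction i)
    case 0
    then show ?case by (simp add: s_0)
  next
    case (Suc i)
    then show ?case using s_less_t[of i] t_less_s[of "Suc i"] by simp
  qed
  have t_le: "t (Suc i) \<le> T" if "i \<le> N" for i
    using that
  proof (induction rule: inc_induct)
    case base
    then show ?case by (simp add: t_last)
  next
    case (step n)
    then show ?case using t_less_s[of "Suc n"] s_less_t[of "Suc n"] by simp
  qed
  have T: "T > 0" using s_nonneg[of N] s_less_t[of N] t_last by simp
  have subset: "?P i \<subseteq> {0..T}" if "i \<le> N" for i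
    using s_nonneg[OF that] t_le[OF that] by auto

  have p: "square_integrable (lebesgue_on (?P i)) p" if "i \<le> N" for i
    using p_L2[OF that] by (simp add: L2_on_iff_square_integrable)
  have p_int: "integrable (lebesgue_on (?P i)) p" if "i \<le> N" for i
    using integral_Ioc_mult_le(1)[OF p[OF that], of "\<lambda>_. 1"] s_less_t[OF that] by simp
  have C1: "AE \<tau> in lebesgue_on (?P i). F i \<tau> C1_differentiable_on UNIV" if "i \<le> N" for i
    using F_C1[OF that] by (simp add: AE_restrict_space_iff)

  obtain a b where ab_all: "continuous_on {0..} a \<and> (\<forall>x\<ge>0. a x \<ge> 0) \<and>
          (\<forall>i\<le>N. set_integrable lebesgue {s i<..<t (Suc i)} b \<and>
             (\<forall>\<tau>\<in>{s i<..<t (Suc i)}. b \<tau> \<ge> 0) \<and>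
             (AE \<tau>\<in>{s i<..<t (Suc i)} in lebesgue.
                (\<forall>x. \<bar>F i \<tau> x\<bar> \<le> a \<bar>x\<bar> * b \<tau> \<and> \<bar>deriv (F i \<tau>) x\<bar> \<le> a \<bar>x\<bar> * b \<tau>) \<and>
                F i \<tau> 0 = 0))"
    using H1 by (elim exE) (rule that)
  have a: "continuous_on {0..} a" using ab_all by (rule conjunct1)
  have b: "set_integrable lebesgue {s i<..<t (Suc i)} b"
    "\<forall>\<tau>\<in>{s i<..<t (Suc i)}. b \<tau> \<ge> 0"
    and ab: "AE \<tau>\<in>{s i<..<t (Suc i)} in lebesgue.
                (\<forall>x. \<bar>F i \<tau> x\<bar> \<le> a \<bar>x\<bar> * b \<tau> \<and> \<bar>deriv (F i \<tau>) x\<bar> \<le> a \<bar>x\<bar> * b \<tau>) \<and>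
                F i \<tau> 0 = 0" if "i \<le> N" for i
    using ab_all[THEN conjunct2, THEN conjunct2, THEN spec, THEN mp, OF that]
    by blast+
  have F0: "AE \<tau> in lebesgue_on (?P i). F i \<tau> 0 = 0" if "i \<le> N" for i
    using AE_lebesgue_on_Ioc[OF ab[OF that]] by eventually_elim simp
  have "\<exists>z\<in>{0..1}. \<forall>x\<in>{0..1}. a x \<le> a z"
    by (rule continuous_attains_sup) (auto intro: continuous_on_subset[OF a])
  then obtain A where A: "\<And>x. x \<in> {0..1} \<Longrightarrow> a x \<le> A" by blast

  define B where "B i \<tau> = A * (indicator {s i<..<t (Suc i)} \<tau> * b \<tau>)" for i \<tau>
  have CF: "Caratheodory_C1 (?P i) (F i) (B i)" if i: "i \<le> N" for i
  proof
    show "(\<lambda>\<tau>. F i \<tau> x) \<in> borel_measurable (lebesgue_on (?P i))" for x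
      using F_meas[OF i, of x] by (simp add: set_borel_measurable_def borel_measurable_restrict_space_iff)
    show "integrable (lebesgue_on (?P i)) (B i)"
      unfolding B_def using integrable_lebesgue_on_indicator_mult[OF b(1)[OF i], of "?P i"] by simp
    have "AE \<tau>\<in>{s i<..<t (Suc i)} in lebesgue. \<forall>x. \<bar>x\<bar> \<le> 1 \<longrightarrow> \<bar>F i \<tau> x\<bar> \<le> B i \<tau> \<and> \<bar>deriv (F i \<tau>) x\<bar> \<le> B i \<tau>"
      using ab[OF i]
    proof eventually_elim
      case (elim \<tau>)
      show ?case
      proof (intro impI allI)
        fix x :: real assume \<tau>: "\<tau> \<in> {s i<..<t (Suc i)}" and x: "\<bar>x\<bar> \<le> 1"
        have "a \<bar>x\<bar> * b \<tau> \<le> A * b \<tau>" using x b(2)[OF i] \<tau> by (intro mult_right_mono A) auto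
        then have "a \<bar>x\<bar> * b \<tau> \<le> B i \<tau>" using \<tau> by (simp add: B_def)
        moreover have "\<bar>F i \<tau> x\<bar> \<le> a \<bar>x\<bar> * b \<tau>" "\<bar>deriv (F i \<tau>) x\<bar> \<le> a \<bar>x\<bar> * b \<tau>"
          using elim \<tau> by blast+
        ultimately show "\<bar>F i \<tau> x\<bar> \<le> B i \<tau> \<and> \<bar>deriv (F i \<tau>) x\<bar> \<le> B i \<tau>" by linarith
      qed
    qed
    then show "AE \<tau> in lebesgue_on (?P i). \<forall>x. \<bar>x\<bar> \<le> 1 \<longrightarrow> \<bar>F i \<tau> x\<bar> \<le> B i \<tau> \<and> \<bar>deriv (F i \<tau>) x\<bar> \<le> B i \<tau>"
      by (rule AE_lebesgue_on_Ioc)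
  qed (use C1[OF i] in auto)

  obtain \<mu> where mu_all: "\<forall>i\<le>N. \<mu> i > (2::real) \<and> (AE \<tau>\<in>?P i in lebesgue. \<forall>x. x \<noteq> 0 \<longrightarrow>
             0 < \<mu> i * F i \<tau> x \<and> \<mu> i * F i \<tau> x \<le> x * deriv (F i \<tau>) x)"
    using H2 by (elim exE) (rule that)
  have mu: "\<mu> i > 2"
    and AR: "AE \<tau>\<in>?P i in lebesgue. \<forall>x. x \<noteq> 0 \<longrightarrow>
             0 < \<mu> i * F i \<tau> x \<and> \<mu> i * F i \<tau> x \<le> x * deriv (F i \<tau>) x" if "i \<le> N" for i
    using mu_all[THEN spec, THEN mp, OF that] by blast+
  let ?M = "\<lambda>i \<tau>. Max (F i \<tau> ` {x. \<bar>x\<bar> = 1})"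
  have F_le: "AE \<tau> in lebesgue_on (?P i). \<forall>x. \<bar>x\<bar> \<le> 1 \<longrightarrow> F i \<tau> x \<le> ?M i \<tau>" if i: "i \<le> N" for i
  proof -
    have "AE \<tau> in lebesgue_on (?P i). \<forall>x. x \<noteq> 0 \<longrightarrow>
             0 < \<mu> i * F i \<tau> x \<and> \<mu> i * F i \<tau> x \<le> x * deriv (F i \<tau>) x"
      using AR[OF i] by (simp add: AE_restrict_space_iff)
    with C1[OF i] F0[OF i] show ?thesis
    proof eventually_elim
      case (elim \<tau>)
      show ?case
        by (intro allI impI superlinear_le_Max_unit_sphere[of "F i \<tau>" "\<mu> i"]) (use elim mu[OF i] in auto)
    qed
  qed
  have M_int: "integrable (lebesgue_on (?P i)) (?M i)" if i: "i \<le> N" for i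
  proof -
    have "integrable (lebesgue_on (?P i)) (\<lambda>\<tau>. F i \<tau> c)" if "\<bar>c\<bar> \<le> 1" for c
      using Caratheodory_C1.composition_integrable[OF CF[OF i], of "\<lambda>_. c"] that by simp
    then show ?thesis unfolding Max_image_abs_eq_1 by (intro integrable_max) auto
  qed

  define \<Phi> where "\<Phi> i \<tau> x = F i \<tau> x + p \<tau> * x" for i \<tau> x
  have C\<Phi>: "Caratheodory_C1 (?P i) (\<Phi> i) (\<lambda>\<tau>. B i \<tau> + \<bar>p \<tau>\<bar>)" if i: "i \<le> N" for i
    unfolding \<Phi>_def[abs_def] by (rule Caratheodory_C1.add_linear(1)[OF CF[OF i] p_int[OF i]])
  have deriv_\<Phi>: "AE \<tau> in lebesgue_on (?P i). \<forall>x. deriv (\<Phi> i \<tau>) x = deriv (F i \<tau>) x + p \<tau>" if i: "i \<le> N" for i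
    unfolding \<Phi>_def[abs_def] by (rule Caratheodory_C1.add_linear(2)[OF CF[OF i] p_int[OF i]])
  interpret split_interval_problem N T s t \<alpha> \<Phi> "\<lambda>i \<tau>. B i \<tau> + \<bar>p \<tau>\<bar>"
    by (rule split_interval_problem.intro) (use T s_nonneg s_less_t t_le C\<Phi> in auto)

  \<comment> \<open>The second summand of \<open>\<beta>\<close> is the Sobolev constant \<open>sqrt T\<close>, and the first one,
    a power, is nonnegative.\<close>
  have "0 \<le> (T * first_eigenvalue T) powr (- 1 / 2)" by simp
  moreover have "T powr (1 / 2) = sqrt T" using T by (simp add: powr_half_sqrt)
  ultimately have beta_ge: "sqrt T \<le> \<beta>" using beta by linarith
  have beta_pos: "\<beta> > 0" using beta_ge T by (meson order_less_le_trans real_sqrt_gt_zero)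
  \<comment> \<open>On the ball of radius \<open>1 / (2 * \<beta>)\<close> all increments are at most \<open>1/2\<close>, and
    \<open>R / 2\<close> is the leading term of \<open>M\<close>.\<close>
  define R where "R = (1 / (2 * \<beta>))\<^sup>2"
  have small: "sqrt R * sqrt T \<le> 1/2"
    unfolding R_def real_sqrt_abs using beta_ge beta_pos by (simp add: field_simps)
  have R_half: "R / 2 = 1 / (8 * \<beta>\<^sup>2)" by (simp add: R_def power2_eq_square)

  let ?norm = "L2_norm T (\<lambda>\<tau>. if \<tau> \<in> (\<Union>i\<in>{0..N}. ?P i) then p \<tau> else 0)"
  \<comment> \<open>The hypothesis on \<open>p\<close> says exactly that \<open>K < R / 2\<close>.\<close>
  define K where "K = 1 / 2 * (\<Sum>i=1..N. \<bar>\<alpha> (i - 1) - \<alpha> i\<bar>)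
     + (\<Sum>i=0..N. (\<integral>\<tau>. ?M i \<tau> \<partial>lebesgue_on (?P i)) + sqrt (?len i) * ?norm)"
  have "\<exists>u g. weak_pair T u g \<and>
    (\<forall>v h. weak_pair T v h \<longrightarrow> (\<integral>x. g x * h x \<partial>lebesgue_on {0<..<T}) = load_deriv u v)"
  proof (rule critical_point_in_ball[OF _ small, of K])
    show "0 \<le> R" by (simp add: R_def)
    show "K < R / 2"
      using H3 unfolding M K_def R_half sum.distrib
      by (simp add: set_lebesgue_integral_eq_lebesgue_on)
    have "(\<integral>\<tau>. \<Phi> i \<tau> 0 \<partial>lebesgue_on (?P i)) = 0" if "i \<le> N" for i
      using F0[OF that] by (intro integral_eq_zero_AE) (simp add: \<Phi>_def)
    then show "load (\<lambda>_. 0) = 0" unfolding load_def by simp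
    show "load u \<le> K" if u: "weak_pair T u g" and R: "energy T g \<le> R" for u g
    proof -
      note inc = increment_bound[OF u R small]
      have cu: "continuous_on {0..T} u" and u0: "u 0 = 0" using u by (auto simp: weak_pair_def)
      have "(\<alpha> (i - 1) - \<alpha> i) * u (t i) \<le> 1 / 2 * \<bar>\<alpha> (i - 1) - \<alpha> i\<bar>" if "i \<in> {1..N}" for i
      proof -
        have "(\<alpha> (i - 1) - \<alpha> i) * u (t i) \<le> \<bar>\<alpha> (i - 1) - \<alpha> i\<bar> * \<bar>u (t i)\<bar>"
          unfolding abs_mult[symmetric] by (rule abs_ge_self)
        also have "\<dots> \<le> \<bar>\<alpha> (i - 1) - \<alpha> i\<bar> * (1 / 2)"
          using inc[OF t_in[OF that], of 0] T u0 by (intro mult_left_mono) auto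
        finally show ?thesis by simp
      qed
      then have jumps: "(\<Sum>i=1..N. (\<alpha> (i - 1) - \<alpha> i) * u (t i)) \<le> 1 / 2 * (\<Sum>i=1..N. \<bar>\<alpha> (i - 1) - \<alpha> i\<bar>)"
        unfolding sum_distrib_left by (rule sum_mono)
      have piece: "(\<integral>\<tau>. \<Phi> i \<tau> (u \<tau> - u (t (Suc i))) \<partial>lebesgue_on (?P i))
        \<le> (\<integral>\<tau>. ?M i \<tau> \<partial>lebesgue_on (?P i)) + sqrt (?len i) * ?norm" if "i \<in> {0..N}" for i
      proof -
        have i: "i \<le> N" using that by simp
        let ?w = "\<lambda>\<tau>. u \<tau> - u (t (Suc i))"
        have w: "?w \<in> borel_measurable (lebesgue_on (?P i))" by (rule increment_measurable[OF cu i])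
        have w1: "\<bar>?w \<tau>\<bar> \<le> 1" if "\<tau> \<in> ?P i" for \<tau>
          using inc[OF subsetD[OF subset[OF i] that] piece_subset(2)[OF i]] by linarith
        note pw = integral_Ioc_mult_le[OF p[OF i] w w1 less_imp_le[OF s_less_t[OF i]]]
        have Fw: "integrable (lebesgue_on (?P i)) (\<lambda>\<tau>. F i \<tau> (?w \<tau>))"
          by (rule Caratheodory_C1.composition_integrable[OF CF[OF i] w w1])
        have "(\<integral>\<tau>. \<Phi> i \<tau> (?w \<tau>) \<partial>lebesgue_on (?P i))
          = (\<integral>\<tau>. F i \<tau> (?w \<tau>) \<partial>lebesgue_on (?P i)) + (\<integral>\<tau>. p \<tau> * ?w \<tau> \<partial>lebesgue_on (?P i))"
          unfolding \<Phi>_def by (rule Bochner_Integration.integral_add[OF Fw pw(1)])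
        also have "(\<integral>\<tau>. F i \<tau> (?w \<tau>) \<partial>lebesgue_on (?P i)) \<le> (\<integral>\<tau>. ?M i \<tau> \<partial>lebesgue_on (?P i))"
        proof (rule integral_mono_AE[OF Fw M_int[OF i]])
          show "AE \<tau> in lebesgue_on (?P i). F i \<tau> (?w \<tau>) \<le> ?M i \<tau>"
            using F_le[OF i] AE_space
          proof eventually_elim
            case (elim \<tau>)
            then have "\<bar>?w \<tau>\<bar> \<le> 1" by (intro w1) simp
            then show ?case using elim(1) by blast
          qed
        qed
        also have "(\<integral>\<tau>. p \<tau> * ?w \<tau> \<partial>lebesgue_on (?P i)) \<le> sqrt (?len i) * sqrt (\<integral>\<tau>. (p \<tau>)\<^sup>2 \<partial>lebesgue_on (?P i))"
          by (rule pw(2))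
        also have "sqrt (\<integral>\<tau>. (p \<tau>)\<^sup>2 \<partial>lebesgue_on (?P i)) \<le> ?norm"
          by (rule L2_norm_piece_le) (use i subset p in auto)
        finally show ?thesis using s_less_t[OF i] by (simp add: mult_left_mono)
      qed
      show ?thesis unfolding load_def K_def by (intro add_mono jumps sum_mono piece)
    qed
  qed
  then obtain u g where u: "weak_pair T u g"
    and crit: "\<And>v h. weak_pair T v h \<Longrightarrow> (\<integral>x. g x * h x \<partial>lebesgue_on {0<..<T}) = load_deriv u v"
    by blast
  have cu: "continuous_on {0..T} u" using u by (simp add: weak_pair_def)
  have "weak_solution N s t \<alpha> F p u"
    unfolding weak_solution_def t_last
  proof (intro conjI exI[of _ g] allI impI)
    show "u \<in> H01 T" "has_weak_L2_deriv T u g" using u by (simp_all add: weak_pair_iff)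
    fix v h assume "v \<in> H01 T" "has_weak_L2_deriv T v h"
    then have v: "weak_pair T v h" by (simp add: weak_pair_iff)
    then have cv: "continuous_on {0..T} v" by (simp add: weak_pair_def)
    have "(\<integral>\<tau>. deriv (\<Phi> i \<tau>) (u \<tau> - u (t (Suc i))) * (v \<tau> - v (t (Suc i))) \<partial>lebesgue_on (?P i))
      = (LINT \<tau>:?P i|lebesgue. (deriv (F i \<tau>) (u \<tau> - u (t (Suc i))) + p \<tau>) * (v \<tau> - v (t (Suc i))))"
      if "i \<in> {0..N}" for i
    proof -
      have i: "i \<le> N" using that by simp
      note wu = increment_measurable[OF cu i] and wv = increment_measurable[OF cv i]
      have pm: "p \<in> borel_measurable (lebesgue_on (?P i))" using p[OF i] by (simp add: square_integrable_def)
      have "(\<integral>\<tau>. deriv (\<Phi> i \<tau>) (u \<tau> - u (t (Suc i))) * (v \<tau> - v (t (Suc i))) \<partial>lebesgue_on (?P i))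
        = (\<integral>\<tau>. (deriv (F i \<tau>) (u \<tau> - u (t (Suc i))) + p \<tau>) * (v \<tau> - v (t (Suc i))) \<partial>lebesgue_on (?P i))"
      proof (rule integral_cong_AE)
        show "(\<lambda>\<tau>. deriv (\<Phi> i \<tau>) (u \<tau> - u (t (Suc i))) * (v \<tau> - v (t (Suc i)))) \<in> borel_measurable (lebesgue_on (?P i))"
          by (intro borel_measurable_times wv Caratheodory_C1.deriv_composition_measurable[OF C\<Phi>[OF i] wu])
        show "(\<lambda>\<tau>. (deriv (F i \<tau>) (u \<tau> - u (t (Suc i))) + p \<tau>) * (v \<tau> - v (t (Suc i)))) \<in> borel_measurable (lebesgue_on (?P i))"
          by (intro borel_measurable_times borel_measurable_add pm wv
              Caratheodory_C1.deriv_composition_measurable[OF CF[OF i] wu])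
        show "AE \<tau> in lebesgue_on (?P i). deriv (\<Phi> i \<tau>) (u \<tau> - u (t (Suc i))) * (v \<tau> - v (t (Suc i)))
          = (deriv (F i \<tau>) (u \<tau> - u (t (Suc i))) + p \<tau>) * (v \<tau> - v (t (Suc i)))"
          using deriv_\<Phi>[OF i] by eventually_elim simp
      qed
      then show ?thesis by (simp add: set_lebesgue_integral_eq_lebesgue_on)
    qed
    then have "load_deriv u v = (\<Sum>i=1..N. (\<alpha> (i - 1) - \<alpha> i) * v (t i))
      + (\<Sum>i=0..N. LINT \<tau>:?P i|lebesgue. (deriv (F i \<tau>) (u \<tau> - u (t (Suc i))) + p \<tau>) * (v \<tau> - v (t (Suc i))))"
      unfolding load_deriv_def by (intro arg_cong2[where f = "(+)"] refl sum.cong) auto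
    moreover have "(LINT \<tau>:{0<..<T}|lebesgue. g \<tau> * h \<tau>) = load_deriv u v"
      using crit[OF v] by (simp add: set_lebesgue_integral_eq_lebesgue_on)
    ultimately show "- (LINT \<tau>:{0<..<T}|lebesgue. g \<tau> * h \<tau>) + (\<Sum>i=1..N. (\<alpha> (i - 1) - \<alpha> i) * v (t i))
      = - (\<Sum>i=0..N. LINT \<tau>:?P i|lebesgue. (deriv (F i \<tau>) (u \<tau> - u (t (Suc i))) + p \<tau>) * (v \<tau> - v (t (Suc i))))"
      by linarith
  qed
  then show ?thesis by blast
qed

end
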